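(* Every connected $k$-graph $\Lambda$ has a universal covering. A connected covering $p:\Omega\to\Lambda$ is universal if and only if $p_*\pi(\Omega,v)=\{x\}$ (the trivial subgroup of $\pi(\Lambda,x)$) for some, hence every, $x\in\Lambda^0$ and $v\in p^{-1}(x)$.
   Context: A $k$-graph is a small category $\Lambda$ (nonempty) with a functor $d:\Lambda\to\mathbb N^k$ (the degree) satisfying the factorization property: if $d(\alpha)=n+l$ with $n,l\in\mathbb N^k$, there are unique $\beta,\gamma\in\Lambda$ with $d(\beta)=n$, $d(\gamma)=l$, $\alpha=\beta\gamma$. $\Lambda^0$ is the set of objects (vertices, identified with identity morphisms); $s(\alpha)$ and $r(\alpha)$ are the domain and codomain of $\alpha$. $u\mathcal C=r^{-1}(u)$, $\mathcal C v=s^{-1}(v)$, $u\mathcal Cv=u\mathcal C\cap\mathcal Cv$. A small category $\mathcal C$ is connected if the equivalence relation on $\mathcal C^0$ generated by $\{(u,v)\mid u\mathcal Cv\neq\emptyset\}$ is all of $\mathcal C^0\times\mathcal C^0$. A $k$-graph morphism is a degree-preserving functor. A covering of $\Lambda$ is a surjective $k$-graph morphism $p:\Omega\to\Lambda$ such that for all $v\in\Omega^0$, $p$ maps $\Omega v$ bijectively onto $\Lambda p(v)$ and $v\Omega$ bijectively onto $p(v)\Lambda$. It is connected if $\Omega$ (hence $\Lambda$) is connected. A morphism of coverings $(\Omega,p)\to(\Sigma,q)$ of $\Lambda$ is a $k$-graph morphism $\phi:\Omega\to\Sigma$ with $q\circ\phi=p$. A covering $p:\Omega\to\Lambda$ is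 universal if it is connected and for every connected covering $q:\Sigma\to\Lambda$ there exists a morphism $(\Omega,p)\to(\Sigma,q)$. For $x\in\Lambda^0$, $p^{-1}(x)$ consists of vertices of $\Omega$. The fundamental groupoid of $\Lambda$ is the groupoid $\mathcal G(\Lambda)$ with $\mathcal G(\Lambda)^0=\Lambda^0$, together with a functor $i:\Lambda\to\mathcal G(\Lambda)$ that is the identity on $\Lambda^0$, such that every functor from $\Lambda$ to a groupoid factors uniquely through $i$. The fundamental group at $x\in\Lambda^0$ is $\pi(\Lambda,x)=x\mathcal G(\Lambda)x$, whose identity element is $x$. A covering $p$ induces homomorphisms $p_*:\pi(\Omega,v)\to\pi(\Lambda,p(v))$. *)

theory Defs
  imports "HOL-Algebra.Group"
begin

section \<open>Small categories, functors and groupoids\<close>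

text \<open>Categories are one-sorted: a vertex (object) is the same thing as its identity morphism.
  \<open>Cmp C \<alpha> \<beta>\<close> is the composite \<open>\<alpha>\<beta>\<close>, meaningful when \<open>Src C \<alpha> = Rng C \<beta>\<close>.\<close>

record 'a cat =
  Arr :: "'a set"
  Src :: "'a \<Rightarrow> 'a"
  Rng :: "'a \<Rightarrow> 'a"
  Cmp :: "'a \<Rightarrow> 'a \<Rightarrow> 'a"

locale category =
  fixes C :: "('a, 'm) cat_scheme"
  assumes src_closed: "\<alpha> \<in> Arr C \<Longrightarrow> Src C \<alpha> \<in> Arr C"
    and rng_closed: "\<alpha> \<in> Arr C \<Longrightarrow> Rng C \<alpha> \<in> Arr C"
    and src_src: "\<alpha> \<in> Arr C \<Longrightarrow> Src C (Src C \<alpha>) = Src C \<alpha>"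
    and rng_src: "\<alpha> \<in> Arr C \<Longrightarrow> Rng C (Src C \<alpha>) = Src C \<alpha>"
    and src_rng: "\<alpha> \<in> Arr C \<Longrightarrow> Src C (Rng C \<alpha>) = Rng C \<alpha>"
    and rng_rng: "\<alpha> \<in> Arr C \<Longrightarrow> Rng C (Rng C \<alpha>) = Rng C \<alpha>"
    and cmp_closed: "\<lbrakk>\<alpha> \<in> Arr C; \<beta> \<in> Arr C; Src C \<alpha> = Rng C \<beta>\<rbrakk> \<Longrightarrow> Cmp C \<alpha> \<beta> \<in> Arr C"
    and src_cmp: "\<lbrakk>\<alpha> \<in> Arr C; \<beta> \<in> Arr C; Src C \<alpha> = Rng C \<beta>\<rbrakk> \<Longrightarrow> Src C (Cmp C \<alpha> \<beta>) = Src C \<beta>"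
    and rng_cmp: "\<lbrakk>\<alpha> \<in> Arr C; \<beta> \<in> Arr C; Src C \<alpha> = Rng C \<beta>\<rbrakk> \<Longrightarrow> Rng C (Cmp C \<alpha> \<beta>) = Rng C \<alpha>"
    and cmp_src: "\<alpha> \<in> Arr C \<Longrightarrow> Cmp C \<alpha> (Src C \<alpha>) = \<alpha>"
    and rng_cmp_id: "\<alpha> \<in> Arr C \<Longrightarrow> Cmp C (Rng C \<alpha>) \<alpha> = \<alpha>"
    and cmp_assoc: "\<lbrakk>\<alpha> \<in> Arr C; \<beta> \<in> Arr C; \<gamma> \<in> Arr C; Src C \<alpha> = Rng C \<beta>; Src C \<beta> = Rng C \<gamma>\<rbrakk>
      \<Longrightarrow> Cmp C (Cmp C \<alpha> \<beta>) \<gamma> = Cmp C \<alpha> (Cmp C \<beta> \<gamma>)"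

definition Ob :: "('a, 'm) cat_scheme \<Rightarrow> 'a set" where
  "Ob C = {v \<in> Arr C. Src C v = v}"

text \<open>\<open>arrows_to C u\<close> is \<open>uC\<close>, and \<open>arrows_from C v\<close> is \<open>Cv\<close>.\<close>

definition arrows_to :: "('a, 'm) cat_scheme \<Rightarrow> 'a \<Rightarrow> 'a set" where
  "arrows_to C u = {\<alpha> \<in> Arr C. Rng C \<alpha> = u}"

definition arrows_from :: "('a, 'm) cat_scheme \<Rightarrow> 'a \<Rightarrow> 'a set" where
  "arrows_from C v = {\<alpha> \<in> Arr C. Src C \<alpha> = v}"

definition connected_cat :: "('a, 'm) cat_scheme \<Rightarrow> bool" where
  "connected_cat C \<longleftrightarrow> (\<forall>u \<in> Ob C. \<forall>v \<in> Ob C.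
     equivclp (\<lambda>u v. u \<in> Ob C \<and> v \<in> Ob C \<and> arrows_to C u \<inter> arrows_from C v \<noteq> {}) u v)"

locale cat_functor = dom: category C + cod: category D
  for C :: "('a, 'm) cat_scheme" and D :: "('b, 'n) cat_scheme" +
  fixes F :: "'a \<Rightarrow> 'b"
  assumes map_closed: "\<alpha> \<in> Arr C \<Longrightarrow> F \<alpha> \<in> Arr D"
    and map_src: "\<alpha> \<in> Arr C \<Longrightarrow> F (Src C \<alpha>) = Src D (F \<alpha>)"
    and map_rng: "\<alpha> \<in> Arr C \<Longrightarrow> F (Rng C \<alpha>) = Rng D (F \<alpha>)"
    and map_cmp: "\<lbrakk>\<alpha> \<in> Arr C; \<beta> \<in> Arr C; Src C \<alpha> = Rng C \<beta>\<rbrakk>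
      \<Longrightarrow> F (Cmp C \<alpha> \<beta>) = Cmp D (F \<alpha>) (F \<beta>)"

definition is_inverse :: "('a, 'm) cat_scheme \<Rightarrow> 'a \<Rightarrow> 'a \<Rightarrow> bool" where
  "is_inverse C \<alpha> \<beta> \<longleftrightarrow> \<beta> \<in> Arr C \<and> Src C \<beta> = Rng C \<alpha> \<and> Rng C \<beta> = Src C \<alpha> \<and>
     Cmp C \<alpha> \<beta> = Rng C \<alpha> \<and> Cmp C \<beta> \<alpha> = Src C \<alpha>"

definition inverse_arrow :: "('a, 'm) cat_scheme \<Rightarrow> 'a \<Rightarrow> 'a" where
  "inverse_arrow C \<alpha> = (THE \<beta>. is_inverse C \<alpha> \<beta>)"

locale groupoid = category C for C :: "('a, 'm) cat_scheme" +
  assumes ex_inverse: "\<alpha> \<in> Arr C \<Longrightarrow> \<exists>\<beta>. is_inverse C \<alpha> \<beta>"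


section \<open>k-graphs and coverings\<close>

text \<open>\<open>\<nat>\<^sup>k\<close> is the set of sequences vanishing from index \<open>k\<close> on; this includes \<open>k = 0\<close>.\<close>

definition degrees :: "nat \<Rightarrow> (nat \<Rightarrow> nat) set" where
  "degrees k = {n. \<forall>i \<ge> k. n i = 0}"

record 'a kgraph = "'a cat" +
  Deg :: "'a \<Rightarrow> nat \<Rightarrow> nat"

locale k_graph = category \<Lambda>
  for k :: nat and \<Lambda> :: "'a kgraph" +
  assumes nonempty: "Arr \<Lambda> \<noteq> {}"
    and deg_closed: "\<alpha> \<in> Arr \<Lambda> \<Longrightarrow> Deg \<Lambda> \<alpha> \<in> degrees k"
    and deg_vertex: "v \<in> Ob \<Lambda> \<Longrightarrow> Deg \<Lambda> v = (\<lambda>i. 0)"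
    and deg_cmp: "\<lbrakk>\<alpha> \<in> Arr \<Lambda>; \<beta> \<in> Arr \<Lambda>; Src \<Lambda> \<alpha> = Rng \<Lambda> \<beta>\<rbrakk>
      \<Longrightarrow> Deg \<Lambda> (Cmp \<Lambda> \<alpha> \<beta>) = (\<lambda>i. Deg \<Lambda> \<alpha> i + Deg \<Lambda> \<beta> i)"
    and factorization: "\<lbrakk>\<alpha> \<in> Arr \<Lambda>; n \<in> degrees k; l \<in> degrees k; Deg \<Lambda> \<alpha> = (\<lambda>i. n i + l i)\<rbrakk>
      \<Longrightarrow> \<exists>!\<beta>\<gamma>. case \<beta>\<gamma> of (\<beta>, \<gamma>) \<Rightarrow> \<beta> \<in> Arr \<Lambda> \<and> \<gamma> \<in> Arr \<Lambda> \<and> Deg \<Lambda> \<beta> = n \<and> Deg \<Lambda> \<gamma> = l \<and>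
            Src \<Lambda> \<beta> = Rng \<Lambda> \<gamma> \<and> \<alpha> = Cmp \<Lambda> \<beta> \<gamma>"

definition kgraph_morphism :: "nat \<Rightarrow> 'a kgraph \<Rightarrow> 'b kgraph \<Rightarrow> ('a \<Rightarrow> 'b) \<Rightarrow> bool" where
  "kgraph_morphism k \<Omega> \<Lambda> f \<longleftrightarrow> k_graph k \<Omega> \<and> k_graph k \<Lambda> \<and> cat_functor \<Omega> \<Lambda> f \<and>
     (\<forall>\<alpha> \<in> Arr \<Omega>. Deg \<Lambda> (f \<alpha>) = Deg \<Omega> \<alpha>)"

definition covering :: "nat \<Rightarrow> 'a kgraph \<Rightarrow> 'b kgraph \<Rightarrow> ('b \<Rightarrow> 'a) \<Rightarrow> bool" where
  "covering k \<Lambda> \<Omega> p \<longleftrightarrow> kgraph_morphism k \<Omega> \<Lambda> p \<and> p ` Arr \<Omega> = Arr \<Lambda> \<and>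
     (\<forall>v \<in> Ob \<Omega>. bij_betw p (arrows_from \<Omega> v) (arrows_from \<Lambda> (p v)) \<and>
                 bij_betw p (arrows_to \<Omega> v) (arrows_to \<Lambda> (p v)))"

definition connected_covering :: "nat \<Rightarrow> 'a kgraph \<Rightarrow> 'b kgraph \<Rightarrow> ('b \<Rightarrow> 'a) \<Rightarrow> bool" where
  "connected_covering k \<Lambda> \<Omega> p \<longleftrightarrow> covering k \<Lambda> \<Omega> p \<and> connected_cat \<Omega>"

definition covering_morphism ::
    "nat \<Rightarrow> 'b kgraph \<Rightarrow> ('b \<Rightarrow> 'a) \<Rightarrow> 'c kgraph \<Rightarrow> ('c \<Rightarrow> 'a) \<Rightarrow> ('b \<Rightarrow> 'c) \<Rightarrow> bool" where
  "covering_morphism k \<Omega> p \<Sigma> q \<phi> \<longleftrightarrow> kgraph_morphism k \<Omega> \<Sigma> \<phi> \<and> (\<forall>\<alpha> \<in> Arr \<Omega>. q (\<phi> \<alpha>) = p \<alpha>)"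

text \<open>HOL cannot quantify over types inside a formula, so the type \<open>'c\<close> in which the morphisms of
  the test coverings \<open>\<Sigma>\<close> live is a parameter of the notion of universal covering.  A connected
  covering of \<open>\<Lambda>\<close> has at most \<open>max \<bar>\<Lambda>\<bar> \<aleph>\<^sub>0\<close> morphisms, so for \<open>\<Lambda> :: 'a kgraph\<close> the choice
  \<open>'c = 'a + nat\<close> already contains every connected covering up to isomorphism.\<close>

definition universal_covering ::
    "'c itself \<Rightarrow> nat \<Rightarrow> 'a kgraph \<Rightarrow> 'b kgraph \<Rightarrow> ('b \<Rightarrow> 'a) \<Rightarrow> bool" where
  "universal_covering _ k \<Lambda> \<Omega> p \<longleftrightarrow> connected_covering k \<Lambda> \<Omega> p \<and>
     (\<forall>(\<Sigma> :: 'c kgraph) q. connected_covering k \<Lambda> \<Sigma> q \<longrightarrow> (\<exists>\<phi>. covering_morphism k \<Omega> p \<Sigma> q \<phi>))"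


section \<open>The fundamental groupoid\<close>

text \<open>The fundamental groupoid is constructed from zigzags, that is, composable words in the
  letters \<open>(\<alpha>, True)\<close>, standing for \<open>\<alpha>\<close>, and \<open>(\<alpha>, False)\<close>, standing for a formal inverse of
  \<open>\<alpha>\<close>.  Its universal property, which determines it, is proved in
  \<open>fundamental_groupoid_factor\<close> and \<open>fundamental_groupoid_factor_unique\<close> below.\<close>

type_synonym 'a letter = "'a \<times> bool"
type_synonym 'a zigzag = "'a \<times> 'a letter list \<times> 'a"

definition letter_rng :: "('a, 'm) cat_scheme \<Rightarrow> 'a letter \<Rightarrow> 'a" where
  "letter_rng C l = (if snd l then Rng C (fst l) else Src C (fst l))"

definition letter_src :: "('a, 'm) cat_scheme \<Rightarrow> 'a letter \<Rightarrow> 'a" where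
  "letter_src C l = (if snd l then Src C (fst l) else Rng C (fst l))"

text \<open>\<open>is_zigzag C x w y\<close>: the word \<open>w\<close> is composable with range \<open>x\<close> and source \<open>y\<close>.\<close>

fun is_zigzag :: "('a, 'm) cat_scheme \<Rightarrow> 'a \<Rightarrow> 'a letter list \<Rightarrow> 'a \<Rightarrow> bool" where
  "is_zigzag C x [] y \<longleftrightarrow> x \<in> Ob C \<and> x = y"
| "is_zigzag C x (l # w) y \<longleftrightarrow> fst l \<in> Arr C \<and> letter_rng C l = x \<and> is_zigzag C (letter_src C l) w y"

inductive reduces :: "('a, 'm) cat_scheme \<Rightarrow> 'a letter list \<Rightarrow> 'a letter list \<Rightarrow> bool"
  for C :: "('a, 'm) cat_scheme" where
  cancel: "reduces C (u @ [(\<alpha>, b), (\<alpha>, \<not> b)] @ v) (u @ v)"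
| compose: "Src C \<alpha> = Rng C \<beta> \<Longrightarrow>
    reduces C (u @ [(\<alpha>, True), (\<beta>, True)] @ v) (u @ [(Cmp C \<alpha> \<beta>, True)] @ v)"

inductive zigzag_step :: "('a, 'm) cat_scheme \<Rightarrow> 'a zigzag \<Rightarrow> 'a zigzag \<Rightarrow> bool"
  for C :: "('a, 'm) cat_scheme" where
  "\<lbrakk>is_zigzag C x w y; is_zigzag C x w' y; reduces C w w'\<rbrakk> \<Longrightarrow> zigzag_step C (x, w, y) (x, w', y)"

definition zigzag_class :: "('a, 'm) cat_scheme \<Rightarrow> 'a zigzag \<Rightarrow> 'a zigzag set" where
  "zigzag_class C z = {z'. equivclp (zigzag_step C) z z'}"

definition representative :: "'a zigzag set \<Rightarrow> 'a zigzag" where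
  "representative X = (SOME z. z \<in> X)"

definition fundamental_groupoid :: "('a, 'm) cat_scheme \<Rightarrow> 'a zigzag set cat" where
  "fundamental_groupoid C =
     \<lparr>Arr = {zigzag_class C (x, w, y) | x w y. is_zigzag C x w y},
      Src = (\<lambda>X. case representative X of (x, w, y) \<Rightarrow> zigzag_class C (y, [], y)),
      Rng = (\<lambda>X. case representative X of (x, w, y) \<Rightarrow> zigzag_class C (x, [], x)),
      Cmp = (\<lambda>X X'. case representative X of (x, w, y) \<Rightarrow> case representative X' of (x', w', y') \<Rightarrow>
               zigzag_class C (x, w @ w', y'))\<rparr>"

text \<open>The canonical functor \<open>i : C \<rightarrow> \<G>(C)\<close>.  A vertex \<open>x\<close> of \<open>C\<close> is identified with the vertex
  \<open>groupoid_incl C x\<close> of \<open>\<G>(C)\<close>; see \<open>groupoid_incl_bij_Ob\<close>.\<close>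

definition groupoid_incl :: "('a, 'm) cat_scheme \<Rightarrow> 'a \<Rightarrow> 'a zigzag set" where
  "groupoid_incl C \<alpha> = zigzag_class C (Rng C \<alpha>, [(\<alpha>, True)], Src C \<alpha>)"

text \<open>The factorization through \<open>\<G>(C)\<close> of a functor \<open>F\<close> from \<open>C\<close> to a groupoid \<open>H\<close>.\<close>

definition zigzag_eval :: "('h, 'n) cat_scheme \<Rightarrow> ('a \<Rightarrow> 'h) \<Rightarrow> 'a letter list \<Rightarrow> 'a \<Rightarrow> 'h" where
  "zigzag_eval H F w y =
     foldr (\<lambda>l. Cmp H (if snd l then F (fst l) else inverse_arrow H (F (fst l)))) w (F y)"

definition groupoid_factor :: "('h, 'n) cat_scheme \<Rightarrow> ('a \<Rightarrow> 'h) \<Rightarrow> 'a zigzag set \<Rightarrow> 'h" where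
  "groupoid_factor H F X = (case representative X of (x, w, y) \<Rightarrow> zigzag_eval H F w y)"

definition fundamental_group :: "('a, 'm) cat_scheme \<Rightarrow> 'a \<Rightarrow> 'a zigzag set monoid" where
  "fundamental_group C x =
     \<lparr>carrier = arrows_to (fundamental_groupoid C) (groupoid_incl C x) \<inter>
                arrows_from (fundamental_groupoid C) (groupoid_incl C x),
      monoid.mult = Cmp (fundamental_groupoid C),
      one = groupoid_incl C x\<rparr>"

text \<open>For a functor \<open>p : \<Omega> \<rightarrow> \<Lambda>\<close>, \<open>induced \<Lambda> p\<close> is the functor \<open>p\<^sub>* : \<G>(\<Omega>) \<rightarrow> \<G>(\<Lambda>)\<close>, i.e. the
  factorization of \<open>i \<circ> p\<close>; it restricts to the homomorphisms of fundamental groups.\<close>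

definition induced :: "('a, 'm) cat_scheme \<Rightarrow> ('b \<Rightarrow> 'a) \<Rightarrow> 'b zigzag set \<Rightarrow> 'a zigzag set" where
  "induced \<Lambda> p = groupoid_factor (fundamental_groupoid \<Lambda>) (groupoid_incl \<Lambda> \<circ> p)"


section \<open>The universal property of the fundamental groupoid\<close>

lemma zigzag_step_bi:
  assumes "zigzag_step C (x,w,y) z' \<or> zigzag_step C z' (x,w,y)" 
  shows "\<exists>w'. z' = (x,w',y) \<and> is_zigzag C x w y \<and> is_zigzag C x w' y"
  using assms by (auto elim: zigzag_step.cases)

lemma homotopic_form:
  assumes "equivclp (zigzag_step C) (x,w,y) z'" "is_zigzag C x w y"
  shows "\<exists>w'. z' = (x,w',y) \<and> is_zigzag C x w' y"
  using assms(1)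
proof (induction rule: equivclp_induct)
  case base
  then show ?case using assms(2) by auto
next
  case (step u v)
  then obtain w' where u: "u = (x,w',y)" by blast
  show ?case using zigzag_step_bi[of C x w' y v] step.hyps(2) u by blast
qed

lemma is_zigzag_append:
  "is_zigzag C x w y \<Longrightarrow> is_zigzag C y w' z \<Longrightarrow> is_zigzag C x (w @ w') z"
  by (induction w arbitrary: x) auto

lemma reduces_context:
  assumes "reduces C w w'" shows "reduces C (u @ w @ v) (u @ w' @ v)"
  using assms
proof cases
  case (cancel u' a b v')
  then show ?thesis using reduces.cancel[of C "u @ u'" a b "v' @ v"] by simp
next
  case (compose a b u' v')
  then show ?thesis using reduces.compose[of C a b "u @ u'" "v' @ v"] by simp
qed

lemma homotopic_context:
  assumes "equivclp (zigzag_step C) (x,w,y) z'" "is_zigzag C x w y"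
    "is_zigzag C x0 u x" "is_zigzag C y v y0" "z' = (x, w', y)"
  shows "equivclp (zigzag_step C) (x0, u @ w @ v, y0) (x0, u @ w' @ v, y0)"
proof -
  have "equivclp (zigzag_step C) (x0, u @ w @ v, y0) (x0, u @ fst (snd z') @ v, y0)"
    using assms(1)
  proof (induction rule: equivclp_induct)
    case base
    then show ?case by simp
  next
    case (step z1 z2)
    obtain w1 where w1: "z1 = (x,w1,y)" using homotopic_form[OF step.hyps(1) assms(2)] by blast
    then obtain w2 where w2: "z2 = (x,w2,y)" and zz: "is_zigzag C x w1 y" "is_zigzag C x w2 y"
      using zigzag_step_bi[of C x w1 y z2] step.hyps(2) by blast
    have red: "reduces C w1 w2 \<or> reduces C w2 w1"
      using step.hyps(2) unfolding w1 w2 by (auto elim: zigzag_step.cases)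
    have z3: "is_zigzag C x0 (u @ w1 @ v) y0" "is_zigzag C x0 (u @ w2 @ v) y0"
      by (intro is_zigzag_append[OF assms(3)] is_zigzag_append[OF _ assms(4)] zz)+
    have "zigzag_step C (x0, u @ w1 @ v, y0) (x0, u @ w2 @ v, y0) \<or>
          zigzag_step C (x0, u @ w2 @ v, y0) (x0, u @ w1 @ v, y0)"
      using red zigzag_step.intros[OF z3 reduces_context] zigzag_step.intros[OF z3(2,1) reduces_context] by blast
    then show ?case using equivclp_into_equivclp[OF step.IH[unfolded w1]] unfolding w2 by simp
  qed
  then show ?thesis using assms(5) by simp
qed

lemma zigzag_class_eqI:
  "equivclp (zigzag_step C) z z' \<Longrightarrow> zigzag_class C z = zigzag_class C z'"
  unfolding zigzag_class_def
  by (rule Collect_cong) (meson equivclp_sym equivclp_trans)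

lemma zigzag_class_eqD:
  "zigzag_class C z = zigzag_class C z' \<Longrightarrow> equivclp (zigzag_step C) z z'"
proof -
  assume "zigzag_class C z = zigzag_class C z'"
  moreover have "z' \<in> zigzag_class C z'" by (simp add: zigzag_class_def)
  ultimately have "z' \<in> zigzag_class C z" by metis
  then show ?thesis by (simp add: zigzag_class_def)
qed

lemma zigzag_class_reduces:
  assumes "is_zigzag C x w y" "is_zigzag C x w' y" "reduces C w w'"
  shows "zigzag_class C (x, w, y) = zigzag_class C (x, w', y)"
  by (rule zigzag_class_eqI) (meson assms zigzag_step.intros r_into_equivclp)

lemma representative_zigzag_class:
  assumes "is_zigzag C x w y"
  obtains w' where "representative (zigzag_class C (x, w, y)) = (x, w', y)"
    "is_zigzag C x w' y" "equivclp (zigzag_step C) (x, w, y) (x, w', y)"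
proof -
  have "(x, w, y) \<in> zigzag_class C (x, w, y)" by (simp add: zigzag_class_def)
  then have "representative (zigzag_class C (x, w, y)) \<in> zigzag_class C (x, w, y)"
    unfolding representative_def by (rule someI)
  then have "equivclp (zigzag_step C) (x, w, y) (representative (zigzag_class C (x, w, y)))"
    by (simp add: zigzag_class_def)
  then show thesis using homotopic_form assms that by metis
qed

lemma Arr_fundamental_groupoid:
  "X \<in> Arr (fundamental_groupoid C) \<longleftrightarrow> (\<exists>x w y. X = zigzag_class C (x, w, y) \<and> is_zigzag C x w y)"
  by (simp add: fundamental_groupoid_def)

lemma zigzag_class_in_Arr:
  "is_zigzag C x w y \<Longrightarrow> zigzag_class C (x, w, y) \<in> Arr (fundamental_groupoid C)"
  unfolding Arr_fundamental_groupoid by blast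

lemma Arr_fundamental_groupoidE:
  assumes "X \<in> Arr (fundamental_groupoid C)"
  obtains x w y where "X = zigzag_class C (x, w, y)" "is_zigzag C x w y"
  using assms unfolding Arr_fundamental_groupoid by blast

lemma Src_fundamental_groupoid:
  assumes "is_zigzag C x w y"
  shows "Src (fundamental_groupoid C) (zigzag_class C (x, w, y)) = zigzag_class C (y, [], y)"
proof -
  obtain w' where "representative (zigzag_class C (x, w, y)) = (x, w', y)"
    using representative_zigzag_class[OF assms] by metis
  then show ?thesis by (simp add: fundamental_groupoid_def)
qed

lemma Rng_fundamental_groupoid:
  assumes "is_zigzag C x w y"
  shows "Rng (fundamental_groupoid C) (zigzag_class C (x, w, y)) = zigzag_class C (x, [], x)"
proof -
  obtain w' where "representative (zigzag_class C (x, w, y)) = (x, w', y)"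
    using representative_zigzag_class[OF assms] by metis
  then show ?thesis by (simp add: fundamental_groupoid_def)
qed

lemma zigzag_class_endpoints:
  assumes "zigzag_class C (x, w, y) = zigzag_class C (x', w', y')" "is_zigzag C x w y"
  shows "x = x'" "y = y'"
  using homotopic_form[OF zigzag_class_eqD[OF assms(1)] assms(2)] by auto

context category
begin

lemma Ob_iff: "v \<in> Ob C \<longleftrightarrow> v \<in> Arr C \<and> Src C v = v \<and> Rng C v = v"
  unfolding Ob_def using rng_src by force

lemma src_Ob: "\<alpha> \<in> Arr C \<Longrightarrow> Src C \<alpha> \<in> Ob C"
  and rng_Ob: "\<alpha> \<in> Arr C \<Longrightarrow> Rng C \<alpha> \<in> Ob C"
  by (simp_all add: Ob_def src_closed rng_closed src_src src_rng)

lemma is_zigzag_Ob: "is_zigzag C x w y \<Longrightarrow> x \<in> Ob C \<and> y \<in> Ob C"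
  by (induction w arbitrary: x) (auto simp: letter_rng_def src_Ob rng_Ob)

lemma is_zigzag_append_iff:
  "is_zigzag C x (w @ w') z \<longleftrightarrow> (\<exists>y. is_zigzag C x w y \<and> is_zigzag C y w' z)"
  by (induction w arbitrary: x) (auto dest: is_zigzag_Ob)

lemma is_zigzag_letter: "\<alpha> \<in> Arr C \<Longrightarrow> is_zigzag C (Rng C \<alpha>) [(\<alpha>, True)] (Src C \<alpha>)"
  by (simp add: letter_rng_def letter_src_def src_Ob)

lemma is_zigzag_letter_inv: "\<alpha> \<in> Arr C \<Longrightarrow> is_zigzag C (Src C \<alpha>) [(\<alpha>, False)] (Rng C \<alpha>)"
  by (simp add: letter_rng_def letter_src_def rng_Ob)

lemma Cmp_fundamental_groupoid:
  assumes "is_zigzag C x w y" "is_zigzag C y w' z"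
  shows "Cmp (fundamental_groupoid C) (zigzag_class C (x, w, y)) (zigzag_class C (y, w', z)) =
    zigzag_class C (x, w @ w', z)"
proof -
  obtain v where v: "representative (zigzag_class C (x, w, y)) = (x, v, y)"
    "is_zigzag C x v y" "equivclp (zigzag_step C) (x, w, y) (x, v, y)"
    using representative_zigzag_class[OF assms(1)] by metis
  obtain v' where v': "representative (zigzag_class C (y, w', z)) = (y, v', z)"
    "is_zigzag C y v' z" "equivclp (zigzag_step C) (y, w', z) (y, v', z)"
    using representative_zigzag_class[OF assms(2)] by metis
  have ob: "is_zigzag C x [] x" "is_zigzag C z [] z" using is_zigzag_Ob assms by auto
  have "equivclp (zigzag_step C) (x, [] @ w @ w', z) (x, [] @ v @ w', z)"
    using homotopic_context[OF v(3) assms(1) ob(1) assms(2)] by simp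
  moreover have "equivclp (zigzag_step C) (x, v @ w' @ [], z) (x, v @ v' @ [], z)"
    using homotopic_context[OF v'(3) assms(2) v(2) ob(2)] by simp
  ultimately have "equivclp (zigzag_step C) (x, w @ w', z) (x, v @ v', z)"
    using equivclp_trans by fastforce
  then show ?thesis using v(1) v'(1) zigzag_class_eqI[of C "(x, w @ w', z)" "(x, v @ v', z)"]
    by (simp add: fundamental_groupoid_def)
qed

lemma groupoid_incl_vertex:
  assumes "x \<in> Ob C" shows "groupoid_incl C x = zigzag_class C (x, [], x)"
proof -
  have x: "x \<in> Arr C" "Src C x = x" "Rng C x = x" using assms Ob_iff by auto
  have c: "Cmp C x x = x" using cmp_src[of x] x by simp
  have z: "is_zigzag C x [] x" "is_zigzag C x [(x, True)] x" "is_zigzag C x [(x, True), (x, False)] x"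
    "is_zigzag C x [(x, True), (x, True), (x, False)] x"
    using x assms by (auto simp: letter_rng_def letter_src_def)
  have "zigzag_class C (x, [(x, True), (x, True), (x, False)], x) = zigzag_class C (x, [(x, True)], x)"
    using zigzag_class_reduces[OF z(4,2)] reduces.cancel[of C "[(x, True)]" x True "[]"] by simp
  moreover have "zigzag_class C (x, [(x, True), (x, True), (x, False)], x) =
      zigzag_class C (x, [(x, True), (x, False)], x)"
    using zigzag_class_reduces[OF z(4,3)] reduces.compose[of C x x "[]" "[(x, False)]"] x c by simp
  moreover have "zigzag_class C (x, [(x, True), (x, False)], x) = zigzag_class C (x, [], x)"
    using zigzag_class_reduces[OF z(3,1)] reduces.cancel[of C "[]" x True "[]"] by simp
  ultimately show ?thesis using x by (simp add: groupoid_incl_def)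
qed

lemma category_fundamental_groupoid: "category (fundamental_groupoid C)"
proof -
  let ?G = "fundamental_groupoid C"
  have nil: "is_zigzag C x [] x \<and> is_zigzag C y [] y" if "is_zigzag C x w y" for x w y
    using is_zigzag_Ob that by simp
  have match: "\<exists>x w y w' z. X = zigzag_class C (x, w, y) \<and> Y = zigzag_class C (y, w', z) \<and>
      is_zigzag C x w y \<and> is_zigzag C y w' z"
    if m: "X \<in> Arr ?G" "Y \<in> Arr ?G" "Src ?G X = Rng ?G Y" for X Y
  proof -
    obtain x w y where X: "X = zigzag_class C (x, w, y)" "is_zigzag C x w y"
      by (rule Arr_fundamental_groupoidE[OF m(1)])
    obtain x' w' y' where Y: "Y = zigzag_class C (x', w', y')" "is_zigzag C x' w' y'"
      by (rule Arr_fundamental_groupoidE[OF m(2)])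
    have "zigzag_class C (y, [], y) = zigzag_class C (x', [], x')"
      using m(3) X Y by (simp add: Src_fundamental_groupoid Rng_fundamental_groupoid)
    then have "y = x'" by (rule zigzag_class_endpoints(1)) (use nil[OF X(2)] in simp)
    then show ?thesis using X Y by blast
  qed
  show ?thesis
  proof
    fix X assume "X \<in> Arr ?G"
    then obtain x w y where X: "X = zigzag_class C (x, w, y)" "is_zigzag C x w y"
      by (rule Arr_fundamental_groupoidE)
    note simps = X(1) Src_fundamental_groupoid[OF X(2)] Rng_fundamental_groupoid[OF X(2)]
      Src_fundamental_groupoid[OF conjunct1[OF nil[OF X(2)]]] Rng_fundamental_groupoid[OF conjunct1[OF nil[OF X(2)]]]
      Src_fundamental_groupoid[OF conjunct2[OF nil[OF X(2)]]] Rng_fundamental_groupoid[OF conjunct2[OF nil[OF X(2)]]]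
      Cmp_fundamental_groupoid[OF conjunct1[OF nil[OF X(2)]] X(2)] Cmp_fundamental_groupoid[OF X(2) conjunct2[OF nil[OF X(2)]]]
    show "Src ?G X \<in> Arr ?G" "Rng ?G X \<in> Arr ?G"
      using zigzag_class_in_Arr[OF conjunct1[OF nil[OF X(2)]]] zigzag_class_in_Arr[OF conjunct2[OF nil[OF X(2)]]]
      by (simp_all add: simps)
    show "Src ?G (Src ?G X) = Src ?G X" "Rng ?G (Src ?G X) = Src ?G X"
      "Src ?G (Rng ?G X) = Rng ?G X" "Rng ?G (Rng ?G X) = Rng ?G X"
      "Cmp ?G X (Src ?G X) = X" "Cmp ?G (Rng ?G X) X = X"
      by (simp_all add: simps)
  next
    fix X Y assume "X \<in> Arr ?G" "Y \<in> Arr ?G" "Src ?G X = Rng ?G Y"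
    then obtain x w y w' z where XY: "X = zigzag_class C (x, w, y)" "Y = zigzag_class C (y, w', z)"
      "is_zigzag C x w y" "is_zigzag C y w' z"
      using match by meson
    note ww = is_zigzag_append[OF XY(3,4)]
    show "Cmp ?G X Y \<in> Arr ?G"
      using Cmp_fundamental_groupoid[OF XY(3,4)] XY(1,2) zigzag_class_in_Arr[OF ww] by simp
    show "Src ?G (Cmp ?G X Y) = Src ?G Y" "Rng ?G (Cmp ?G X Y) = Rng ?G X"
      using Cmp_fundamental_groupoid[OF XY(3,4)] XY ww
      by (simp_all add: Src_fundamental_groupoid Rng_fundamental_groupoid)
  next
    fix X Y Z assume a: "X \<in> Arr ?G" "Y \<in> Arr ?G" "Z \<in> Arr ?G"
      "Src ?G X = Rng ?G Y" "Src ?G Y = Rng ?G Z"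
    obtain x w y w' z where XY: "X = zigzag_class C (x, w, y)" "Y = zigzag_class C (y, w', z)"
      "is_zigzag C x w y" "is_zigzag C y w' z"
      using match a by meson
    obtain y1 w1 z1 w2 t where YZ: "Y = zigzag_class C (y1, w1, z1)" "Z = zigzag_class C (z1, w2, t)"
      "is_zigzag C y1 w1 z1" "is_zigzag C z1 w2 t"
      using match a by meson
    have "z1 = z" using zigzag_class_endpoints(2)[of C y w' z y1 w1 z1] XY(2,4) YZ(1) by simp
    then have Z: "Z = zigzag_class C (z, w2, t)" "is_zigzag C z w2 t" using YZ by auto
    show "Cmp ?G (Cmp ?G X Y) Z = Cmp ?G X (Cmp ?G Y Z)"
      using Cmp_fundamental_groupoid[OF XY(3,4)] Cmp_fundamental_groupoid[OF XY(4) Z(2)]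
        Cmp_fundamental_groupoid[OF is_zigzag_append[OF XY(3,4)] Z(2)]
        Cmp_fundamental_groupoid[OF XY(3) is_zigzag_append[OF XY(4) Z(2)]] XY(1,2) Z(1)
      by simp
  qed
qed

lemma zigzag_class_inverse:
  "is_zigzag C x w y \<Longrightarrow> \<exists>w'. is_zigzag C y w' x \<and>
     zigzag_class C (x, w @ w', x) = zigzag_class C (x, [], x) \<and>
     zigzag_class C (y, w' @ w, y) = zigzag_class C (y, [], y)"
proof (induction w arbitrary: x)
  case Nil
  then show ?case by (intro exI[of _ "[]"]) auto
next
  case (Cons l w)
  obtain a b where l: "l = (a, b)" by fastforce
  let ?l = "(a, \<not> b)"
  let ?s = "letter_src C l"
  let ?G = "fundamental_groupoid C"
  interpret G: category ?G by (rule category_fundamental_groupoid)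
  have a: "a \<in> Arr C" "letter_rng C l = x" "is_zigzag C ?s w y" using Cons.prems l by auto
  then obtain w' where w': "is_zigzag C y w' ?s"
     "zigzag_class C (?s, w @ w', ?s) = zigzag_class C (?s, [], ?s)"
     "zigzag_class C (y, w' @ w, y) = zigzag_class C (y, [], y)"
    using Cons.IH by blast
  have ob: "x \<in> Ob C" "?s \<in> Ob C"
    using is_zigzag_Ob[OF Cons.prems] is_zigzag_Ob[OF a(3)] by (blast, blast)
  have zl: "is_zigzag C x [l] ?s" "is_zigzag C ?s [?l] x"
    using ob a l by (auto simp: letter_rng_def letter_src_def split: if_splits)
  have z: "is_zigzag C y (w' @ [?l]) x" using is_zigzag_append[OF w'(1) zl(2)] .
  have ll: "zigzag_class C (x, [l] @ [?l], x) = zigzag_class C (x, [], x)"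
    using zigzag_class_reduces[OF is_zigzag_append[OF zl], of "[]"] ob
      reduces.cancel[of C "[]" a b "[]"] l by simp
  have ll': "zigzag_class C (?s, [?l] @ [l], ?s) = zigzag_class C (?s, [], ?s)"
    using zigzag_class_reduces[OF is_zigzag_append[OF zl(2,1)], of "[]"] ob
      reduces.cancel[of C "[]" a "\<not> b" "[]"] l by simp
  have h1: "equivclp (zigzag_step C) (x, [l] @ (w @ w') @ [?l], x) (x, [l] @ [] @ [?l], x)"
    using homotopic_context[OF zigzag_class_eqD[OF w'(2)] is_zigzag_append[OF a(3) w'(1)] zl] by simp
  have h2: "equivclp (zigzag_step C) (y, w' @ ([?l] @ [l]) @ w, y) (y, w' @ [] @ w, y)"
    using homotopic_context[OF zigzag_class_eqD[OF ll'] is_zigzag_append[OF zl(2,1)] w'(1) a(3)] by simp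
  show ?case
    using z zigzag_class_eqI[OF h1] zigzag_class_eqI[OF h2] ll w'(3)
    by (intro exI[of _ "w' @ [?l]"]) simp
qed

theorem groupoid_fundamental_groupoid: "groupoid (fundamental_groupoid C)"
proof -
  interpret G: category "fundamental_groupoid C" by (rule category_fundamental_groupoid)
  show ?thesis
  proof
    fix X assume "X \<in> Arr (fundamental_groupoid C)"
    then obtain x w y where X: "X = zigzag_class C (x, w, y)" "is_zigzag C x w y"
      by (rule Arr_fundamental_groupoidE)
    then obtain w' where w': "is_zigzag C y w' x"
     "zigzag_class C (x, w @ w', x) = zigzag_class C (x, [], x)"
     "zigzag_class C (y, w' @ w, y) = zigzag_class C (y, [], y)"
      using zigzag_class_inverse by blast
    have "zigzag_class C (y, w', x) \<in> Arr (fundamental_groupoid C)"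
      by (rule zigzag_class_in_Arr[OF w'(1)])
    then have "is_inverse (fundamental_groupoid C) X (zigzag_class C (y, w', x))"
      using X w' unfolding is_inverse_def
      by (simp add: Src_fundamental_groupoid Rng_fundamental_groupoid Cmp_fundamental_groupoid)
    then show "\<exists>Y. is_inverse (fundamental_groupoid C) X Y" by blast
  qed
qed

theorem functor_groupoid_incl: "cat_functor C (fundamental_groupoid C) (groupoid_incl C)"
proof -
  interpret G: category "fundamental_groupoid C" by (rule category_fundamental_groupoid)
  show ?thesis
  proof
    fix \<alpha> assume \<alpha>: "\<alpha> \<in> Arr C"
    note z = is_zigzag_letter[OF \<alpha>]
    show "groupoid_incl C \<alpha> \<in> Arr (fundamental_groupoid C)"
      unfolding groupoid_incl_def by (rule zigzag_class_in_Arr[OF z])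
    show "groupoid_incl C (Src C \<alpha>) = Src (fundamental_groupoid C) (groupoid_incl C \<alpha>)"
      using groupoid_incl_vertex[OF src_Ob[OF \<alpha>]] Src_fundamental_groupoid[OF z]
      by (simp add: groupoid_incl_def)
    show "groupoid_incl C (Rng C \<alpha>) = Rng (fundamental_groupoid C) (groupoid_incl C \<alpha>)"
      using groupoid_incl_vertex[OF rng_Ob[OF \<alpha>]] Rng_fundamental_groupoid[OF z]
      by (simp add: groupoid_incl_def)
  next
    fix \<alpha> \<beta> assume ab: "\<alpha> \<in> Arr C" "\<beta> \<in> Arr C" "Src C \<alpha> = Rng C \<beta>"
    have z: "is_zigzag C (Rng C \<alpha>) [(\<alpha>, True)] (Rng C \<beta>)" using is_zigzag_letter ab by metis
    have r: "reduces C ([(\<alpha>, True)] @ [(\<beta>, True)]) [(Cmp C \<alpha> \<beta>, True)]"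
      using reduces.compose[of C \<alpha> \<beta> "[]" "[]"] ab by simp
    have "is_zigzag C (Rng C \<alpha>) [(Cmp C \<alpha> \<beta>, True)] (Src C \<beta>)"
      using is_zigzag_letter[OF cmp_closed[OF ab]] unfolding src_cmp[OF ab] rng_cmp[OF ab] .
    then show "groupoid_incl C (Cmp C \<alpha> \<beta>) =
        Cmp (fundamental_groupoid C) (groupoid_incl C \<alpha>) (groupoid_incl C \<beta>)"
      using zigzag_class_reduces[OF is_zigzag_append[OF z is_zigzag_letter[OF ab(2)]] _ r]
        Cmp_fundamental_groupoid[OF z is_zigzag_letter[OF ab(2)]] ab src_cmp[OF ab] rng_cmp[OF ab] src_Ob[OF ab(2)]
      by (simp add: groupoid_incl_def)
  qed
qed

theorem groupoid_incl_bij_Ob: "bij_betw (groupoid_incl C) (Ob C) (Ob (fundamental_groupoid C))"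
proof (rule bij_betwI')
  fix x y assume xy: "x \<in> Ob C" "y \<in> Ob C"
  show "(groupoid_incl C x = groupoid_incl C y) = (x = y)"
    using zigzag_class_endpoints(1)[of C x "[]" x y "[]" y] groupoid_incl_vertex xy by auto
next
  interpret i: cat_functor C "fundamental_groupoid C" "groupoid_incl C" by (rule functor_groupoid_incl)
  fix x assume "x \<in> Ob C"
  then show "groupoid_incl C x \<in> Ob (fundamental_groupoid C)"
    using i.map_closed i.map_src[of x] by (simp add: Ob_def)
next
  fix X assume "X \<in> Ob (fundamental_groupoid C)"
  then have "X \<in> Arr (fundamental_groupoid C)" and s: "Src (fundamental_groupoid C) X = X"
    by (auto simp: Ob_def)
  then obtain x w y where X: "X = zigzag_class C (x, w, y)" "is_zigzag C x w y"
    by (metis Arr_fundamental_groupoidE)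
  have "y \<in> Ob C" using is_zigzag_Ob X by blast
  moreover have "X = groupoid_incl C y"
    using s X Src_fundamental_groupoid groupoid_incl_vertex \<open>y \<in> Ob C\<close> by metis
  ultimately show "\<exists>x\<in>Ob C. X = groupoid_incl C x" by blast
qed

end

context groupoid
begin

lemma is_inverse_unique:
  assumes "\<alpha> \<in> Arr C" "is_inverse C \<alpha> \<beta>" "is_inverse C \<alpha> \<gamma>"
  shows "\<beta> = \<gamma>"
proof -
  have "\<beta> = Cmp C \<beta> (Cmp C \<alpha> \<gamma>)" using assms cmp_src[of \<beta>] by (simp add: is_inverse_def)
  also have "\<dots> = Cmp C (Cmp C \<beta> \<alpha>) \<gamma>" using assms cmp_assoc[of \<beta> \<alpha> \<gamma>] by (simp add: is_inverse_def)
  also have "\<dots> = \<gamma>" using assms rng_cmp_id[of \<gamma>] by (simp add: is_inverse_def)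
  finally show ?thesis .
qed

lemma inverse_arrow: "\<alpha> \<in> Arr C \<Longrightarrow> is_inverse C \<alpha> (inverse_arrow C \<alpha>)"
  unfolding inverse_arrow_def by (rule theI') (use ex_inverse is_inverse_unique in blast)

lemma inverse_arrow_eq: "\<alpha> \<in> Arr C \<Longrightarrow> is_inverse C \<alpha> \<beta> \<Longrightarrow> inverse_arrow C \<alpha> = \<beta>"
  using inverse_arrow is_inverse_unique by blast

end

locale functor_to_groupoid = cat_functor C H F + H: groupoid H
  for C :: "('a, 'm) cat_scheme" and H :: "('h, 'n) cat_scheme" and F :: "'a \<Rightarrow> 'h"
begin

definition letter_map :: "'a letter \<Rightarrow> 'h" where
  "letter_map l = (if snd l then F (fst l) else inverse_arrow H (F (fst l)))"

lemma zigzag_eval_simps [simp]: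
  "zigzag_eval H F [] y = F y"
  "zigzag_eval H F (l # w) y = Cmp H (letter_map l) (zigzag_eval H F w y)"
  by (simp_all add: zigzag_eval_def letter_map_def)

lemma letter_map:
  assumes "fst l \<in> Arr C"
  shows "letter_map l \<in> Arr H" "Rng H (letter_map l) = F (letter_rng C l)"
    "Src H (letter_map l) = F (letter_src C l)"
  using assms H.inverse_arrow[OF map_closed[OF assms]]
  by (auto simp: letter_map_def letter_rng_def letter_src_def map_closed map_src map_rng is_inverse_def)

lemma F_Ob: "x \<in> Ob C \<Longrightarrow> F x \<in> Ob H"
  by (auto simp: Ob_def map_closed map_src[symmetric])

lemma zigzag_eval:
  "is_zigzag C x w y \<Longrightarrow> zigzag_eval H F w y \<in> Arr H \<and> Rng H (zigzag_eval H F w y) = F x \<and>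
     Src H (zigzag_eval H F w y) = F y"
proof (induction w arbitrary: x)
  case Nil
  then show ?case using F_Ob cod.Ob_iff by auto
next
  case (Cons l w)
  then show ?case using letter_map[of l] cod.cmp_closed cod.rng_cmp cod.src_cmp by auto
qed

lemma zigzag_eval_append:
  "is_zigzag C x w y \<Longrightarrow> is_zigzag C y w' z \<Longrightarrow>
     zigzag_eval H F (w @ w') z = Cmp H (zigzag_eval H F w y) (zigzag_eval H F w' z)"
proof (induction w arbitrary: x)
  case Nil
  then show ?case using zigzag_eval[OF Nil(2)] cod.rng_cmp_id by (metis append_Nil is_zigzag.simps(1) zigzag_eval_simps(1))
next
  case (Cons l w)
  then have *: "fst l \<in> Arr C" "is_zigzag C (letter_src C l) w y" by auto
  show ?case using Cons.IH[OF *(2) Cons.prems(2)] letter_map[OF *(1)] zigzag_eval[OF *(2)]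
      zigzag_eval[OF Cons.prems(2)] by (simp add: cod.cmp_assoc)
qed

lemma zigzag_eval_reduces:
  assumes "is_zigzag C x w y" "is_zigzag C x w' y" "reduces C w w'"
  shows "zigzag_eval H F w y = zigzag_eval H F w' y"
  using assms(3)
proof cases
  case (cancel u a b v)
  obtain t where t: "is_zigzag C x u t" "is_zigzag C t ([(a, b), (a, \<not> b)] @ v) y"
    using assms(1) cancel dom.is_zigzag_append_iff by metis
  have a: "a \<in> Arr C" and v: "is_zigzag C t v y" and tr: "letter_rng C (a, b) = t"
    using t(2) by (auto simp: letter_rng_def letter_src_def split: if_splits)
  have inv: "Cmp H (letter_map (a, b)) (letter_map (a, \<not> b)) = F t"
    using H.inverse_arrow[OF map_closed[OF a]] tr
    by (auto simp: letter_map_def is_inverse_def letter_rng_def map_rng[OF a] map_src[OF a])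
  have "zigzag_eval H F ([(a, b), (a, \<not> b)] @ v) y =
      Cmp H (Cmp H (letter_map (a, b)) (letter_map (a, \<not> b))) (zigzag_eval H F v y)"
    using letter_map[of "(a, b)"] letter_map[of "(a, \<not> b)"] a zigzag_eval[OF v] tr
    by (subst cod.cmp_assoc) (auto simp: letter_rng_def letter_src_def)
  also have "\<dots> = zigzag_eval H F v y"
    using inv zigzag_eval[OF v] cod.rng_cmp_id by metis
  finally show ?thesis
    using cancel zigzag_eval_append[OF t] zigzag_eval_append[OF t(1) v] by simp
next
  case (compose a b u v)
  obtain t where t: "is_zigzag C x u t" "is_zigzag C t ([(a, True), (b, True)] @ v) y"
    using assms(1) compose dom.is_zigzag_append_iff by metis
  have ab: "a \<in> Arr C" "b \<in> Arr C" "Rng C a = t" and v: "is_zigzag C (Src C b) v y"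
    using t(2) by (auto simp: letter_rng_def letter_src_def)
  have t': "is_zigzag C t ([(Cmp C a b, True)] @ v) y"
    using ab v compose(3) by (simp add: letter_rng_def letter_src_def dom.cmp_closed dom.src_cmp dom.rng_cmp)
  have "zigzag_eval H F ([(a, True), (b, True)] @ v) y = zigzag_eval H F ([(Cmp C a b, True)] @ v) y"
    using zigzag_eval[OF v] ab compose(3) map_src[OF ab(1)] map_rng[OF ab(2)] map_src[OF ab(2)]
    by (simp add: letter_map_def map_cmp map_closed cod.cmp_assoc)
  then show ?thesis
    using compose zigzag_eval_append[OF t] zigzag_eval_append[OF t(1) t'] by simp
qed

lemma zigzag_eval_homotopic:
  assumes "equivclp (zigzag_step C) (x, w, y) z" "is_zigzag C x w y"
  shows "zigzag_eval H F w y = zigzag_eval H F (fst (snd z)) y"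
  using assms(1)
proof (induction rule: equivclp_induct)
  case base
  then show ?case by simp
next
  case (step z1 z2)
  obtain w1 where w1: "z1 = (x, w1, y)" using homotopic_form[OF step.hyps(1) assms(2)] by blast
  then obtain w2 where w2: "z2 = (x, w2, y)" and zz: "is_zigzag C x w1 y" "is_zigzag C x w2 y"
    using zigzag_step_bi[of C x w1 y z2] step.hyps(2) by blast
  have red: "reduces C w1 w2 \<or> reduces C w2 w1"
    using step.hyps(2) unfolding w1 w2 by (auto elim: zigzag_step.cases)
  then have "zigzag_eval H F w1 y = zigzag_eval H F w2 y"
    using zigzag_eval_reduces zz by metis
  then show ?case using step.IH w1 w2 by simp
qed

lemma groupoid_factor_class:
  assumes "is_zigzag C x w y"
  shows "groupoid_factor H F (zigzag_class C (x, w, y)) = zigzag_eval H F w y"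
proof -
  obtain w' where "representative (zigzag_class C (x, w, y)) = (x, w', y)"
    "equivclp (zigzag_step C) (x, w, y) (x, w', y)"
    using representative_zigzag_class[OF assms] by metis
  then show ?thesis using zigzag_eval_homotopic assms by (fastforce simp: groupoid_factor_def)
qed

text \<open>Every functor \<open>F\<close> from \<open>C\<close> to a groupoid \<open>H\<close> (over an arbitrary type) factors uniquely
  through \<open>i : C \<rightarrow> \<G>(C)\<close>.\<close>

theorem fundamental_groupoid_factor:
  "cat_functor (fundamental_groupoid C) H (groupoid_factor H F)"
  "\<alpha> \<in> Arr C \<Longrightarrow> groupoid_factor H F (groupoid_incl C \<alpha>) = F \<alpha>"
proof -
  let ?G = "fundamental_groupoid C"
  interpret G: category ?G by (rule dom.category_fundamental_groupoid)
  show "cat_functor ?G H (groupoid_factor H F)"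
  proof
    fix X assume "X \<in> Arr ?G"
    then obtain x w y where X: "X = zigzag_class C (x, w, y)" "is_zigzag C x w y"
      by (rule Arr_fundamental_groupoidE)
    have ob: "is_zigzag C x [] x" "is_zigzag C y [] y" using dom.is_zigzag_Ob X by auto
    note e = zigzag_eval[OF X(2)]
    show "groupoid_factor H F X \<in> Arr H"
      "groupoid_factor H F (Src ?G X) = Src H (groupoid_factor H F X)"
      "groupoid_factor H F (Rng ?G X) = Rng H (groupoid_factor H F X)"
      using X e ob by (simp_all only: groupoid_factor_class Src_fundamental_groupoid
          Rng_fundamental_groupoid zigzag_eval_simps)
  next
    fix X Y assume XY: "X \<in> Arr ?G" "Y \<in> Arr ?G" "Src ?G X = Rng ?G Y"
    obtain x w y where X: "X = zigzag_class C (x, w, y)" "is_zigzag C x w y"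
      by (rule Arr_fundamental_groupoidE[OF XY(1)])
    obtain x' w' y' where Y: "Y = zigzag_class C (x', w', y')" "is_zigzag C x' w' y'"
      by (rule Arr_fundamental_groupoidE[OF XY(2)])
    have "zigzag_class C (y, [], y) = zigzag_class C (x', [], x')"
      using XY(3) X Y by (simp add: Src_fundamental_groupoid Rng_fundamental_groupoid)
    then have [simp]: "x' = y" using zigzag_class_endpoints(1)[of C y "[]" y x' "[]" x'] dom.is_zigzag_Ob[OF X(2)]
      by simp
    show "groupoid_factor H F (Cmp ?G X Y) = Cmp H (groupoid_factor H F X) (groupoid_factor H F Y)"
      using X Y is_zigzag_append[OF X(2), of w' y']
      by (simp add: dom.Cmp_fundamental_groupoid groupoid_factor_class zigzag_eval_append)
  qed
  assume \<alpha>: "\<alpha> \<in> Arr C"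
  show "groupoid_factor H F (groupoid_incl C \<alpha>) = F \<alpha>"
    using groupoid_factor_class[OF dom.is_zigzag_letter[OF \<alpha>]] cod.cmp_src[OF map_closed[OF \<alpha>]]
    by (simp add: groupoid_incl_def letter_map_def map_src[OF \<alpha>])
qed

theorem fundamental_groupoid_factor_unique:
  assumes "cat_functor (fundamental_groupoid C) H \<Phi>"
    and "\<And>\<alpha>. \<alpha> \<in> Arr C \<Longrightarrow> \<Phi> (groupoid_incl C \<alpha>) = F \<alpha>"
    and "X \<in> Arr (fundamental_groupoid C)"
  shows "\<Phi> X = groupoid_factor H F X"
proof -
  let ?G = "fundamental_groupoid C"
  interpret \<Phi>: cat_functor ?G H \<Phi> by (rule assms(1))
  have ob: "\<Phi> (zigzag_class C (y, [], y)) = F y" if "y \<in> Ob C" for y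
    using assms(2)[of y] dom.groupoid_incl_vertex[OF that] that by (simp add: Ob_def)
  have letter: "\<Phi> (zigzag_class C (letter_rng C l, [l], letter_src C l)) = letter_map l"
    if l: "fst l \<in> Arr C" for l
  proof -
    obtain a b where ab: "l = (a, b)" by fastforce
    then have a: "a \<in> Arr C" using l by simp
    let ?A = "zigzag_class C (Rng C a, [(a, True)], Src C a)"
    let ?B = "zigzag_class C (Src C a, [(a, False)], Rng C a)"
    note z = dom.is_zigzag_letter[OF a] dom.is_zigzag_letter_inv[OF a]
    have A: "?A \<in> Arr ?G" "?B \<in> Arr ?G" by (rule zigzag_class_in_Arr[OF z(1)], rule zigzag_class_in_Arr[OF z(2)])
    have AB: "Src ?G ?A = Rng ?G ?B" "Src ?G ?B = Rng ?G ?A"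
      by (simp_all only: Src_fundamental_groupoid[OF z(1)] Rng_fundamental_groupoid[OF z(1)]
          Src_fundamental_groupoid[OF z(2)] Rng_fundamental_groupoid[OF z(2)])
    have FA: "\<Phi> ?A = F a" using assms(2)[OF a] by (simp add: groupoid_incl_def)
    have "Cmp ?G ?A ?B = zigzag_class C (Rng C a, [], Rng C a)"
      using dom.Cmp_fundamental_groupoid[OF z] zigzag_class_reduces[OF is_zigzag_append[OF z], of "[]"]
        reduces.cancel[of C "[]" a True "[]"] dom.rng_Ob[OF a] by simp
    moreover have "Cmp ?G ?B ?A = zigzag_class C (Src C a, [], Src C a)"
      using dom.Cmp_fundamental_groupoid[OF z(2,1)] zigzag_class_reduces[OF is_zigzag_append[OF z(2,1)], of "[]"]
        reduces.cancel[of C "[]" a False "[]"] dom.src_Ob[OF a] by simp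
    ultimately have "Cmp H (\<Phi> ?A) (\<Phi> ?B) = F (Rng C a)" "Cmp H (\<Phi> ?B) (\<Phi> ?A) = F (Src C a)"
      using \<Phi>.map_cmp[OF A AB(1)] \<Phi>.map_cmp[OF A(2,1) AB(2)] ob dom.rng_Ob[OF a] dom.src_Ob[OF a]
      by simp_all
    moreover have "Src H (\<Phi> ?B) = Rng H (\<Phi> ?A)" "Rng H (\<Phi> ?B) = Src H (\<Phi> ?A)"
      using AB \<Phi>.map_src \<Phi>.map_rng A by metis+
    ultimately have "is_inverse H (F a) (\<Phi> ?B)"
      using \<Phi>.map_closed[OF A(2)] FA map_src[OF a] map_rng[OF a] by (simp add: is_inverse_def)
    then have "\<Phi> ?B = inverse_arrow H (F a)" using H.inverse_arrow_eq map_closed[OF a] by metis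
    then show ?thesis using FA ab by (simp add: letter_map_def letter_rng_def letter_src_def)
  qed
  have "\<Phi> (zigzag_class C (x, w, y)) = zigzag_eval H F w y" if "is_zigzag C x w y" for x w y
    using that
  proof (induction w arbitrary: x)
    case Nil
    then show ?case using ob[of y] by auto
  next
    case (Cons l w)
    then have l: "fst l \<in> Arr C" and x: "letter_rng C l = x" and w: "is_zigzag C (letter_src C l) w y"
      by auto
    have zl: "is_zigzag C x [l] (letter_src C l)" using l x dom.is_zigzag_Ob w by simp
    have arr: "zigzag_class C (x, [l], letter_src C l) \<in> Arr ?G"
      "zigzag_class C (letter_src C l, w, y) \<in> Arr ?G"
      by (rule zigzag_class_in_Arr[OF zl], rule zigzag_class_in_Arr[OF w])
    have "\<Phi> (zigzag_class C (x, l # w, y)) = Cmp H (\<Phi> (zigzag_class C (x, [l], letter_src C l)))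
        (\<Phi> (zigzag_class C (letter_src C l, w, y)))"
      using dom.Cmp_fundamental_groupoid[OF zl w] \<Phi>.map_cmp[OF arr]
        Src_fundamental_groupoid[OF zl] Rng_fundamental_groupoid[OF w] by simp
    then show ?case using letter[OF l] x Cons.IH[OF w] by simp
  qed
  then show ?thesis using assms(3) groupoid_factor_class by (auto simp: Arr_fundamental_groupoid)
qed

end

lemma (in category) group_fundamental_group:
  assumes "x \<in> Ob C" shows "group (fundamental_group C x)"
proof -
  let ?G = "fundamental_groupoid C"
  interpret G: groupoid ?G by (rule groupoid_fundamental_groupoid)
  have i: "groupoid_incl C x \<in> Ob ?G" using groupoid_incl_bij_Ob assms bij_betwE by metis
  then have i': "groupoid_incl C x \<in> Arr ?G" "Src ?G (groupoid_incl C x) = groupoid_incl C x"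
    "Rng ?G (groupoid_incl C x) = groupoid_incl C x" using G.Ob_iff by auto
  note defs = fundamental_group_def arrows_to_def arrows_from_def
  show ?thesis
  proof (rule groupI)
    fix X assume X: "X \<in> carrier (fundamental_group C x)"
    then have "X \<in> Arr ?G" by (simp add: defs)
    then obtain Y where Y: "is_inverse ?G X Y" using G.ex_inverse by blast
    have "Y \<in> carrier (fundamental_group C x)" "Cmp ?G Y X = groupoid_incl C x"
      using X Y by (auto simp: defs is_inverse_def)
    then show "\<exists>Y\<in>carrier (fundamental_group C x).
        Y \<otimes>\<^bsub>fundamental_group C x\<^esub> X = \<one>\<^bsub>fundamental_group C x\<^esub>"
      by (auto simp: defs)
  next
    fix X assume "X \<in> carrier (fundamental_group C x)"
    then show "\<one>\<^bsub>fundamental_group C x\<^esub> \<otimes>\<^bsub>fundamental_group C x\<^esub> X = X"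
      using G.rng_cmp_id[of X] by (simp add: defs)
  qed (use i' in \<open>auto simp: defs G.cmp_closed G.src_cmp G.rng_cmp G.cmp_assoc\<close>)
qed

lemma induced_functor:
  assumes "cat_functor \<Omega> \<Lambda> p"
  shows "cat_functor (fundamental_groupoid \<Omega>) (fundamental_groupoid \<Lambda>) (induced \<Lambda> p)"
    and "\<alpha> \<in> Arr \<Omega> \<Longrightarrow> induced \<Lambda> p (groupoid_incl \<Omega> \<alpha>) = groupoid_incl \<Lambda> (p \<alpha>)"
proof -
  interpret p: cat_functor \<Omega> \<Lambda> p by (rule assms)
  interpret i: cat_functor \<Lambda> "fundamental_groupoid \<Lambda>" "groupoid_incl \<Lambda>"
    by (rule p.cod.functor_groupoid_incl)
  interpret G: groupoid "fundamental_groupoid \<Lambda>" by (rule p.cod.groupoid_fundamental_groupoid)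
  interpret ip: functor_to_groupoid \<Omega> "fundamental_groupoid \<Lambda>" "groupoid_incl \<Lambda> \<circ> p"
    by unfold_locales
      (simp_all add: p.map_closed p.map_src p.map_rng p.map_cmp i.map_closed i.map_src i.map_rng,
       metis i.map_cmp p.map_closed p.map_src p.map_rng)
  show "cat_functor (fundamental_groupoid \<Omega>) (fundamental_groupoid \<Lambda>) (induced \<Lambda> p)"
    unfolding induced_def by (rule ip.fundamental_groupoid_factor(1))
  show "\<alpha> \<in> Arr \<Omega> \<Longrightarrow> induced \<Lambda> p (groupoid_incl \<Omega> \<alpha>) = groupoid_incl \<Lambda> (p \<alpha>)"
    unfolding induced_def using ip.fundamental_groupoid_factor(2) by simp
qed

lemma induced_hom:
  assumes "cat_functor \<Omega> \<Lambda> p" "v \<in> Ob \<Omega>"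
  shows "induced \<Lambda> p \<in> hom (fundamental_group \<Omega> v) (fundamental_group \<Lambda> (p v))"
proof -
  interpret P: cat_functor "fundamental_groupoid \<Omega>" "fundamental_groupoid \<Lambda>" "induced \<Lambda> p"
    by (rule induced_functor(1)[OF assms(1)])
  have v: "induced \<Lambda> p (groupoid_incl \<Omega> v) = groupoid_incl \<Lambda> (p v)"
    using induced_functor(2)[OF assms(1)] assms(2) by (simp add: Ob_def)
  show ?thesis
    using v P.map_src P.map_rng
    by (auto simp: hom_def fundamental_group_def arrows_to_def arrows_from_def P.map_closed P.map_cmp
        simp flip: P.map_src P.map_rng)
qed

end

theory Submission
  imports Defs
begin

text \<open>Fix a base point \<open>x\<close>.  The homotopy classes of zigzags from \<open>x\<close>, that is, the elements of
  \<open>x\<G>(\<Lambda>)\<close>, are the vertices of a connected covering of \<open>\<Lambda>\<close>: over an arrow \<open>\<alpha>\<close> there is one arrow from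
  \<open>g[\<alpha>]\<close> to \<open>g\<close> for each \<open>g\<close>.  A loop of \<open>\<Lambda>\<close> lifts to a loop of this covering only if it is trivial
  in \<open>\<G>(\<Lambda>)\<close>, so every covering \<open>p\<close> mapping to it, in particular every universal one, has trivial
  \<open>p\<^sub>*\<pi>\<close>.  Conversely, zigzags lift uniquely along a covering \<open>q\<close>, and the endpoint of a lift depends only
  on the homotopy class.  Hence if \<open>p\<close> is connected with trivial \<open>p\<^sub>*\<pi>(\<Omega>, v)\<close>, a vertex \<open>y\<close> of \<open>\<Omega>\<close> can
  be sent to the endpoint of the \<open>q\<close>-lift of the image of any zigzag from \<open>v\<close> to \<open>y\<close>, and this extends
  to a morphism of coverings from \<open>p\<close> to \<open>q\<close>.\<close>

section \<open>Zigzags and functors\<close>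

abbreviation zigzag_map :: "('a \<Rightarrow> 'b) \<Rightarrow> 'a letter list \<Rightarrow> 'b letter list" where
  "zigzag_map f \<equiv> map (apfst f)"

context cat_functor
begin

lemma map_Ob: "v \<in> Ob C \<Longrightarrow> F v \<in> Ob D"
  by (auto simp: Ob_def map_closed simp flip: map_src)

lemma letter_rng_map: "fst l \<in> Arr C \<Longrightarrow> letter_rng D (apfst F l) = F (letter_rng C l)"
  and letter_src_map: "fst l \<in> Arr C \<Longrightarrow> letter_src D (apfst F l) = F (letter_src C l)"
  by (auto simp: letter_rng_def letter_src_def map_src map_rng)

lemma is_zigzag_map: "is_zigzag C x w y \<Longrightarrow> is_zigzag D (F x) (zigzag_map F w) (F y)"
  by (induction w arbitrary: x) (auto simp: map_Ob map_closed letter_rng_map letter_src_map)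

end

section \<open>The functor \<open>induced\<close> on classes of zigzags\<close>

lemma (in category) inverse_arrow_letter:
  assumes "\<alpha> \<in> Arr C"
  shows "inverse_arrow (fundamental_groupoid C) (groupoid_incl C \<alpha>) =
    zigzag_class C (Src C \<alpha>, [(\<alpha>, False)], Rng C \<alpha>)"
proof -
  interpret G: groupoid "fundamental_groupoid C" by (rule groupoid_fundamental_groupoid)
  note z = is_zigzag_letter[OF assms] is_zigzag_letter_inv[OF assms]
  have "zigzag_class C (Rng C \<alpha>, [(\<alpha>, True), (\<alpha>, False)], Rng C \<alpha>) = zigzag_class C (Rng C \<alpha>, [], Rng C \<alpha>)"
    using zigzag_class_reduces[OF is_zigzag_append[OF z], of "[]"]
      reduces.cancel[of C "[]" \<alpha> True "[]"] rng_Ob[OF assms] by simp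
  moreover have "zigzag_class C (Src C \<alpha>, [(\<alpha>, False), (\<alpha>, True)], Src C \<alpha>) = zigzag_class C (Src C \<alpha>, [], Src C \<alpha>)"
    using zigzag_class_reduces[OF is_zigzag_append[OF z(2,1)], of "[]"]
      reduces.cancel[of C "[]" \<alpha> False "[]"] src_Ob[OF assms] by simp
  ultimately have "is_inverse (fundamental_groupoid C) (groupoid_incl C \<alpha>)
      (zigzag_class C (Src C \<alpha>, [(\<alpha>, False)], Rng C \<alpha>))"
    unfolding is_inverse_def groupoid_incl_def
    using Cmp_fundamental_groupoid[OF z] Cmp_fundamental_groupoid[OF z(2,1)] zigzag_class_in_Arr[OF z(2)]
    by (simp add: Src_fundamental_groupoid[OF z(1)] Rng_fundamental_groupoid[OF z(1)]
        Src_fundamental_groupoid[OF z(2)] Rng_fundamental_groupoid[OF z(2)])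
  then show ?thesis
    using G.inverse_arrow_eq zigzag_class_in_Arr[OF z(1)] by (simp add: groupoid_incl_def)
qed

text \<open>Evaluated letter by letter in the fundamental groupoid of \<Lambda>, a word yields the
  class of its image, a backward letter being handled by \<open>inverse_arrow_letter\<close>. Hence
  \<open>p\<close> may be applied to words directly.\<close>

lemma induced_zigzag_class:
  assumes "cat_functor \<Omega> \<Lambda> p" "is_zigzag \<Omega> x w y"
  shows "induced \<Lambda> p (zigzag_class \<Omega> (x, w, y)) = zigzag_class \<Lambda> (p x, zigzag_map p w, p y)"
proof -
  interpret p: cat_functor \<Omega> \<Lambda> p by (rule assms)
  interpret i: cat_functor \<Lambda> "fundamental_groupoid \<Lambda>" "groupoid_incl \<Lambda>"
    by (rule p.cod.functor_groupoid_incl)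
  interpret G: groupoid "fundamental_groupoid \<Lambda>" by (rule p.cod.groupoid_fundamental_groupoid)
  interpret ip: functor_to_groupoid \<Omega> "fundamental_groupoid \<Lambda>" "groupoid_incl \<Lambda> \<circ> p"
    by unfold_locales
      (simp_all add: p.map_closed p.map_src p.map_rng p.map_cmp i.map_closed i.map_src i.map_rng,
       metis i.map_cmp p.map_closed p.map_src p.map_rng)
  have "zigzag_eval (fundamental_groupoid \<Lambda>) (groupoid_incl \<Lambda> \<circ> p) w y =
      zigzag_class \<Lambda> (p x, zigzag_map p w, p y)"
    using assms(2)
  proof (induction w arbitrary: x)
    case Nil
    then have "x = y" "y \<in> Ob \<Omega>" by auto
    then show ?case using p.cod.groupoid_incl_vertex[OF p.map_Ob] by (simp add: zigzag_eval_def)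
  next
    case (Cons l w)
    then have l: "fst l \<in> Arr \<Omega>" and x: "letter_rng \<Omega> l = x" and w: "is_zigzag \<Omega> (letter_src \<Omega> l) w y"
      by auto
    obtain a b where ab: "l = (a, b)" by fastforce
    have a: "a \<in> Arr \<Omega>" using l ab by simp
    have e: "ip.letter_map l = zigzag_class \<Lambda> (p x, [apfst p l], p (letter_src \<Omega> l))"
      unfolding ip.letter_map_def x[symmetric] ab
      using p.cod.inverse_arrow_letter[OF p.map_closed[OF a]]
      by (simp add: groupoid_incl_def letter_rng_def letter_src_def p.map_src[OF a] p.map_rng[OF a])
    have z: "is_zigzag \<Lambda> (p x) [apfst p l] (p (letter_src \<Omega> l))"
      using p.is_zigzag_map[of x "[l]" "letter_src \<Omega> l"] l x p.dom.is_zigzag_Ob[OF w] p.map_Ob by simp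
    show ?case
      unfolding ip.zigzag_eval_simps e Cons.IH[OF w]
      using p.cod.Cmp_fundamental_groupoid[OF z p.is_zigzag_map[OF w]] by simp
  qed
  then show ?thesis
    using ip.groupoid_factor_class[OF assms(2)] by (simp add: induced_def)
qed

text \<open>A class determines the endpoints of its words, and the vertex of the groupoid at
  \<open>x\<close> is the class of the empty word, so a loop at this vertex is represented by
  zigzags from \<open>x\<close> to \<open>x\<close>.\<close>

lemma (in category) fundamental_group_carrier:
  assumes "x \<in> Ob C"
  shows "carrier (fundamental_group C x) = {zigzag_class C (x, w, x) |w. is_zigzag C x w x}"
proof (intro equalityI subsetI)
  fix X assume X: "X \<in> carrier (fundamental_group C x)"
  then have G: "X \<in> Arr (fundamental_groupoid C)" "Rng (fundamental_groupoid C) X = groupoid_incl C x"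
    "Src (fundamental_groupoid C) X = groupoid_incl C x"
    by (auto simp: fundamental_group_def arrows_to_def arrows_from_def)
  obtain a w b where w: "X = zigzag_class C (a, w, b)" "is_zigzag C a w b"
    by (rule Arr_fundamental_groupoidE[OF G(1)])
  have "a \<in> Ob C" "b \<in> Ob C" using is_zigzag_Ob w(2) by blast+
  then have "a = x" "b = x"
    using G(2,3) w groupoid_incl_vertex[OF assms] Rng_fundamental_groupoid[OF w(2)] Src_fundamental_groupoid[OF w(2)]
      zigzag_class_endpoints(1)[of C a "[]" a x "[]" x] zigzag_class_endpoints(1)[of C b "[]" b x "[]" x]
    by auto
  then show "X \<in> {zigzag_class C (x, w, x) |w. is_zigzag C x w x}" using w by blast
next
  fix X assume "X \<in> {zigzag_class C (x, w, x) |w. is_zigzag C x w x}"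
  then obtain w where w: "X = zigzag_class C (x, w, x)" "is_zigzag C x w x" by blast
  then show "X \<in> carrier (fundamental_group C x)"
    using zigzag_class_in_Arr[OF w(2)] Rng_fundamental_groupoid[OF w(2)] Src_fundamental_groupoid[OF w(2)]
      groupoid_incl_vertex[OF assms]
    by (simp add: fundamental_group_def arrows_to_def arrows_from_def)
qed

section \<open>Loops with null-homotopic image\<close>

definition null_loops :: "('a, 'm) cat_scheme \<Rightarrow> ('b, 'n) cat_scheme \<Rightarrow> ('b \<Rightarrow> 'a) \<Rightarrow> 'b \<Rightarrow> bool" where
  "null_loops \<Lambda> \<Omega> p v \<longleftrightarrow> (\<forall>w. is_zigzag \<Omega> v w v \<longrightarrow>
     zigzag_class \<Lambda> (p v, zigzag_map p w, p v) = zigzag_class \<Lambda> (p v, [], p v))"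

text \<open>The image consists of the classes of images of loops, so triviality of
  \<open>p\<^sub>*\<pi>\<close> becomes a condition on words, the form that lifting arguments can
  use.\<close>

lemma induced_trivial_iff:
  assumes "cat_functor \<Omega> \<Lambda> p" "v \<in> Ob \<Omega>"
  shows "induced \<Lambda> p ` carrier (fundamental_group \<Omega> v) = {\<one>\<^bsub>fundamental_group \<Lambda> (p v)\<^esub>} \<longleftrightarrow>
    null_loops \<Lambda> \<Omega> p v"
proof -
  interpret p: cat_functor \<Omega> \<Lambda> p by (rule assms)
  have one: "\<one>\<^bsub>fundamental_group \<Lambda> (p v)\<^esub> = zigzag_class \<Lambda> (p v, [], p v)"
    using p.cod.groupoid_incl_vertex[OF p.map_Ob[OF assms(2)]] by (simp add: fundamental_group_def)
  have im: "induced \<Lambda> p ` carrier (fundamental_group \<Omega> v) =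
      {zigzag_class \<Lambda> (p v, zigzag_map p w, p v) |w. is_zigzag \<Omega> v w v}"
    unfolding p.dom.fundamental_group_carrier[OF assms(2)]
    using induced_zigzag_class[OF assms(1), of v _ v] by (auto simp: image_def)
  \<comment> \<open>The empty loop makes the image nonempty, which turns inclusion in the singleton
    into equality.\<close>
  have "is_zigzag \<Omega> v [] v" using assms(2) by simp
  then have "{zigzag_class \<Lambda> (p v, zigzag_map p w, p v) |w. is_zigzag \<Omega> v w v} \<noteq> {}" by blast
  then show ?thesis unfolding im one null_loops_def by blast
qed

text \<open>Let \<open>u\<close> be an inverse path of \<open>w'\<close>. For classes of images in
  \<Lambda>, \<open>[w] = [w][u @ w'] = [w @ u][w'] = [w']\<close>: the word \<open>u @ w'\<close>
  is trivial already in \<Omega>, and \<open>w @ u\<close> is a loop at \<open>v\<close>.\<close>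

lemma null_loops_paths:
  assumes "cat_functor \<Omega> \<Lambda> p" "null_loops \<Lambda> \<Omega> p v" "is_zigzag \<Omega> v w y" "is_zigzag \<Omega> v w' y"
  shows "zigzag_class \<Lambda> (p v, zigzag_map p w, p y) = zigzag_class \<Lambda> (p v, zigzag_map p w', p y)"
proof -
  interpret p: cat_functor \<Omega> \<Lambda> p by (rule assms)
  obtain u where u: "is_zigzag \<Omega> y u v" "zigzag_class \<Omega> (y, u @ w', y) = zigzag_class \<Omega> (y, [], y)"
    using p.dom.zigzag_class_inverse[OF assms(4)] by blast
  have y: "is_zigzag \<Omega> y [] y" using p.dom.is_zigzag_Ob[OF assms(3)] by simp
  have v: "is_zigzag \<Omega> v [] v" using p.dom.is_zigzag_Ob[OF assms(3)] by simp
  note zwu = is_zigzag_append[OF assms(3) u(1)]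
  note zuw = is_zigzag_append[OF u(1) assms(4)]
  have "zigzag_class \<Lambda> (p y, zigzag_map p (u @ w'), p y) = zigzag_class \<Lambda> (p y, [], p y)"
    using induced_zigzag_class[OF assms(1) zuw] induced_zigzag_class[OF assms(1) y] u(2) by simp
  then have "zigzag_class \<Lambda> (p v, zigzag_map p w @ zigzag_map p (u @ w'), p y) = zigzag_class \<Lambda> (p v, zigzag_map p w @ [], p y)"
    using p.cod.Cmp_fundamental_groupoid[OF p.is_zigzag_map[OF assms(3)] p.is_zigzag_map[OF zuw]]
      p.cod.Cmp_fundamental_groupoid[OF p.is_zigzag_map[OF assms(3)] p.is_zigzag_map[OF y]] by simp
  moreover have "zigzag_class \<Lambda> (p v, zigzag_map p (w @ u), p v) = zigzag_class \<Lambda> (p v, [], p v)"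
    using assms(2) zwu unfolding null_loops_def by blast
  then have "zigzag_class \<Lambda> (p v, zigzag_map p (w @ u) @ zigzag_map p w', p y) = zigzag_class \<Lambda> (p v, [] @ zigzag_map p w', p y)"
    using p.cod.Cmp_fundamental_groupoid[OF p.is_zigzag_map[OF zwu] p.is_zigzag_map[OF assms(4)]]
      p.cod.Cmp_fundamental_groupoid[OF p.is_zigzag_map[OF v] p.is_zigzag_map[OF assms(4)]] by simp
  ultimately show ?thesis by simp
qed

section \<open>Connectedness in terms of zigzags\<close>

context category
begin

lemma is_zigzag_letters: "is_zigzag C x w y \<Longrightarrow> l \<in> set w \<Longrightarrow> fst l \<in> Arr C"
  by (induction w arbitrary: x) auto

lemma is_zigzag_endpoint: "is_zigzag C x w y \<Longrightarrow> is_zigzag C x w z \<Longrightarrow> y = z"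
  by (induction w arbitrary: x) auto

lemma equivclp_of_zigzag:
  assumes "is_zigzag C x w y"
  shows "equivclp (\<lambda>u v. u \<in> Ob C \<and> v \<in> Ob C \<and> arrows_to C u \<inter> arrows_from C v \<noteq> {}) x y"
    (is "equivclp ?R x y")
  using assms
proof (induction w arbitrary: x)
  case Nil
  then show ?case by simp
next
  case (Cons l w)
  then have "fst l \<in> Arr C" by simp
  then have "?R (Rng C (fst l)) (Src C (fst l))"
    by (auto simp: src_Ob rng_Ob arrows_to_def arrows_from_def)
  then have "equivclp ?R (Rng C (fst l)) (Src C (fst l))" by (rule r_into_equivclp)
  then have "equivclp ?R x (letter_src C l)"
    using Cons.prems by (auto simp: letter_rng_def letter_src_def intro: equivclp_sym)
  then show ?case using Cons equivclp_trans by fastforce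
qed

lemma zigzag_reverse: "is_zigzag C x w y \<Longrightarrow> \<exists>w'. is_zigzag C y w' x"
  using zigzag_class_inverse by blast

lemma connected_cat_zigzag:
  assumes "connected_cat C" "x \<in> Ob C" "y \<in> Ob C"
  shows "\<exists>w. is_zigzag C x w y"
proof -
  have "equivclp (\<lambda>u v. u \<in> Ob C \<and> v \<in> Ob C \<and> arrows_to C u \<inter> arrows_from C v \<noteq> {}) x y"
    using assms by (simp add: connected_cat_def)
  then show ?thesis
  proof (induction rule: equivclp_induct)
    case base
    then show ?case using assms(2) by (intro exI[of _ "[]"]) simp
  next
    case (step u v)
    have "\<exists>w. is_zigzag C u w v"
      using step.hyps(2) is_zigzag_letter is_zigzag_letter_inv unfolding arrows_to_def arrows_from_def by blast
    then show ?case using step.IH is_zigzag_append[of C x _ u _ v] by blast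
  qed
qed

text \<open>Zigzags can be reversed and concatenated, so it suffices to reach every vertex from one
  base point.\<close>

lemma connected_catI:
  assumes "\<And>y. y \<in> Ob C \<Longrightarrow> \<exists>w. is_zigzag C x w y"
  shows "connected_cat C"
  unfolding connected_cat_def
proof (intro ballI)
  fix u v assume "u \<in> Ob C" "v \<in> Ob C"
  then obtain w where "is_zigzag C u w v"
    using assms zigzag_reverse is_zigzag_append by meson
  then show "equivclp (\<lambda>u v. u \<in> Ob C \<and> v \<in> Ob C \<and> arrows_to C u \<inter> arrows_from C v \<noteq> {}) u v"
    by (rule equivclp_of_zigzag)
qed

end

section \<open>Lifting zigzags along a covering\<close>

locale kgraph_covering =
  fixes k :: nat and \<Lambda> :: "'a kgraph" and \<Omega> :: "'b kgraph" and p :: "'b \<Rightarrow> 'a"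
  assumes covering: "covering k \<Lambda> \<Omega> p"
begin

sublocale total: k_graph k \<Omega>
  using covering by (simp add: covering_def kgraph_morphism_def)

sublocale base: k_graph k \<Lambda>
  using covering by (simp add: covering_def kgraph_morphism_def)

sublocale cat_functor \<Omega> \<Lambda> p
  using covering by (simp add: covering_def kgraph_morphism_def)

lemma deg_map: "\<alpha> \<in> Arr \<Omega> \<Longrightarrow> Deg \<Lambda> (p \<alpha>) = Deg \<Omega> \<alpha>"
  using covering by (simp add: covering_def kgraph_morphism_def)

lemma lift_rng_unique:
  assumes "\<alpha> \<in> Arr \<Omega>" "\<beta> \<in> Arr \<Omega>" "Rng \<Omega> \<alpha> = Rng \<Omega> \<beta>" "p \<alpha> = p \<beta>"
  shows "\<alpha> = \<beta>"
proof -
  have "inj_on p (arrows_to \<Omega> (Rng \<Omega> \<alpha>))"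
    using covering total.rng_Ob[OF assms(1)] by (auto simp: covering_def bij_betw_def)
  then show ?thesis using assms by (auto simp: arrows_to_def dest: inj_onD)
qed

lemma lift_src_unique:
  assumes "\<alpha> \<in> Arr \<Omega>" "\<beta> \<in> Arr \<Omega>" "Src \<Omega> \<alpha> = Src \<Omega> \<beta>" "p \<alpha> = p \<beta>"
  shows "\<alpha> = \<beta>"
proof -
  have "inj_on p (arrows_from \<Omega> (Src \<Omega> \<alpha>))"
    using covering total.src_Ob[OF assms(1)] by (auto simp: covering_def bij_betw_def)
  then show ?thesis using assms by (auto simp: arrows_from_def dest: inj_onD)
qed

lemma lift_rng:
  assumes "v \<in> Ob \<Omega>" "\<alpha> \<in> Arr \<Lambda>" "Rng \<Lambda> \<alpha> = p v"
  obtains \<beta> where "\<beta> \<in> Arr \<Omega>" "Rng \<Omega> \<beta> = v" "p \<beta> = \<alpha>"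
proof -
  have "p ` arrows_to \<Omega> v = arrows_to \<Lambda> (p v)"
    using covering assms(1) by (auto simp: covering_def bij_betw_def)
  moreover have "\<alpha> \<in> arrows_to \<Lambda> (p v)" using assms by (simp add: arrows_to_def)
  ultimately show thesis using that by (smt (verit) arrows_to_def imageE mem_Collect_eq)
qed

lemma lift_src:
  assumes "v \<in> Ob \<Omega>" "\<alpha> \<in> Arr \<Lambda>" "Src \<Lambda> \<alpha> = p v"
  obtains \<beta> where "\<beta> \<in> Arr \<Omega>" "Src \<Omega> \<beta> = v" "p \<beta> = \<alpha>"
proof -
  have "p ` arrows_from \<Omega> v = arrows_from \<Lambda> (p v)"
    using covering assms(1) by (auto simp: covering_def bij_betw_def)
  moreover have "\<alpha> \<in> arrows_from \<Lambda> (p v)" using assms by (simp add: arrows_from_def)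
  ultimately show thesis using that by (smt (verit) arrows_from_def imageE mem_Collect_eq)
qed

text \<open>Surjectivity of \<open>p\<close> concerns arrows. The source of a preimage of
  \<open>x\<close> is a vertex, and it still lies over \<open>x\<close> because \<open>p\<close>
  commutes with sources.\<close>

lemma vertex_lift:
  assumes "x \<in> Ob \<Lambda>" obtains v where "v \<in> Ob \<Omega>" "p v = x"
proof -
  have "x \<in> p ` Arr \<Omega>" using covering assms by (simp add: covering_def Ob_def)
  then obtain \<alpha> where "\<alpha> \<in> Arr \<Omega>" "p \<alpha> = x" by blast
  then show thesis using that[of "Src \<Omega> \<alpha>"] assms total.src_Ob map_src by (simp add: Ob_def[of \<Lambda>])
qed

text \<open>The lift is built letter by letter: a forward letter is lifted at its range and a
  backward one at its source, by the two bijections of a covering.\<close>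

lemma zigzag_lift:
  assumes "v \<in> Ob \<Omega>" "is_zigzag \<Lambda> (p v) w y"
  shows "\<exists>W u. is_zigzag \<Omega> v W u \<and> zigzag_map p W = w"
  using assms
proof (induction w arbitrary: v)
  case Nil
  then show ?case by (intro exI[of _ "[]"]) simp
next
  case (Cons l w)
  obtain \<alpha> b where l: "l = (\<alpha>, b)" by fastforce
  have "\<exists>\<beta>. \<beta> \<in> Arr \<Omega> \<and> letter_rng \<Omega> (\<beta>, b) = v \<and> p \<beta> = \<alpha>"
    using Cons.prems l lift_rng[OF Cons.prems(1), of \<alpha>] lift_src[OF Cons.prems(1), of \<alpha>]
    by (cases b) (auto simp: letter_rng_def)
  then obtain \<beta> where \<beta>: "\<beta> \<in> Arr \<Omega>" "letter_rng \<Omega> (\<beta>, b) = v" "p \<beta> = \<alpha>" by blast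
  have "letter_src \<Omega> (\<beta>, b) \<in> Ob \<Omega>" using \<beta>(1) by (simp add: letter_src_def total.src_Ob total.rng_Ob)
  moreover have "is_zigzag \<Lambda> (p (letter_src \<Omega> (\<beta>, b))) w y"
    using Cons.prems(2) l \<beta> letter_src_map[of "(\<beta>, b)"] by simp
  ultimately obtain W u where "is_zigzag \<Omega> (letter_src \<Omega> (\<beta>, b)) W u" "zigzag_map p W = w"
    using Cons.IH by blast
  then show ?case using \<beta> l by (intro exI[of _ "(\<beta>, b) # W"] exI[of _ u]) simp
qed

lemma letter_lift_unique:
  assumes "fst l \<in> Arr \<Omega>" "fst l' \<in> Arr \<Omega>" "letter_rng \<Omega> l = letter_rng \<Omega> l'" "apfst p l = apfst p l'"
  shows "l = l'"
  using assms lift_rng_unique[of "fst l" "fst l'"] lift_src_unique[of "fst l" "fst l'"]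
  by (cases l; cases l') (auto simp: letter_rng_def split: if_splits)

lemma zigzag_lift_unique:
  assumes "is_zigzag \<Omega> v W u" "is_zigzag \<Omega> v W' u'" "zigzag_map p W = zigzag_map p W'"
  shows "u = u'"
  using assms
proof (induction W arbitrary: v W')
  case Nil
  then show ?case by auto
next
  case (Cons l W)
  then obtain l' V where W': "W' = l' # V" by (cases W') auto
  have "l = l'" by (rule letter_lift_unique) (use Cons.prems W' in auto)
  then show ?case using Cons.IH[of "letter_src \<Omega> l" V] Cons.prems W' by simp
qed

text \<open>This is the local step of homotopy lifting. A cancelling pair lifts to a cancelling pair
  by uniqueness of lifts, and a composable pair lifts to a composable pair because \<open>W\<close>
  is a zigzag.\<close>

lemma reduces_lift:
  assumes "is_zigzag \<Omega> v W u" "reduces \<Lambda> (zigzag_map p W) w'"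
  shows "\<exists>W'. is_zigzag \<Omega> v W' u \<and> zigzag_map p W' = w'"
  using assms(2)
proof cases
  case (cancel a \<alpha> b c)
  obtain A l1 l2 B where W: "W = A @ [l1, l2] @ B" "zigzag_map p A = a" "apfst p l1 = (\<alpha>, b)"
    "apfst p l2 = (\<alpha>, \<not> b)" "zigzag_map p B = c"
    using cancel(1) by (auto simp: map_eq_append_conv map_eq_Cons_conv append_eq_map_conv)
  obtain t where t: "is_zigzag \<Omega> v A t" "is_zigzag \<Omega> t ([l1, l2] @ B) u"
    using assms(1) W(1) total.is_zigzag_append_iff by metis
  have l: "fst l1 \<in> Arr \<Omega>" "fst l2 \<in> Arr \<Omega>" "letter_rng \<Omega> l1 = t" "letter_rng \<Omega> l2 = letter_src \<Omega> l1"
    "is_zigzag \<Omega> (letter_src \<Omega> l2) B u" using t(2) by auto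
  \<comment> \<open>Both letters have range \<open>letter_src \<Omega> l1\<close> and lie over
    \<open>(\<alpha>, \<not> b)\<close>, so unique lifting identifies them.\<close>
  have "(fst l1, \<not> snd l1) = l2"
    by (rule letter_lift_unique) (use l W in \<open>auto simp: letter_rng_def letter_src_def prod_eq_iff\<close>)
  then have "is_zigzag \<Omega> t B u"
    using l by (auto simp: letter_rng_def letter_src_def split: if_splits)
  then show ?thesis using is_zigzag_append[OF t(1)] W cancel(2) by (intro exI[of _ "A @ B"]) simp
next
  case (compose \<alpha> \<beta> a c)
  obtain A l1 l2 B where W: "W = A @ [l1, l2] @ B" "zigzag_map p A = a" "apfst p l1 = (\<alpha>, True)"
    "apfst p l2 = (\<beta>, True)" "zigzag_map p B = c"
    using compose(1) by (auto simp: map_eq_append_conv map_eq_Cons_conv append_eq_map_conv)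
  obtain t where t: "is_zigzag \<Omega> v A t" "is_zigzag \<Omega> t ([l1, l2] @ B) u"
    using assms(1) W(1) total.is_zigzag_append_iff by metis
  have s: "snd l1" "snd l2" "p (fst l1) = \<alpha>" "p (fst l2) = \<beta>" using W by (auto simp: prod_eq_iff)
  then have l: "fst l1 \<in> Arr \<Omega>" "fst l2 \<in> Arr \<Omega>" "Rng \<Omega> (fst l1) = t" "Src \<Omega> (fst l1) = Rng \<Omega> (fst l2)"
    "is_zigzag \<Omega> (Src \<Omega> (fst l2)) B u" using t(2) by (auto simp: letter_rng_def letter_src_def)
  have "is_zigzag \<Omega> t ([(Cmp \<Omega> (fst l1) (fst l2), True)] @ B) u"
    using l by (simp add: letter_rng_def letter_src_def total.cmp_closed total.src_cmp total.rng_cmp)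
  then show ?thesis using is_zigzag_append[OF t(1)] W compose(2) s map_cmp[OF l(1,2,4)]
    by (intro exI[of _ "A @ [(Cmp \<Omega> (fst l1) (fst l2), True)] @ B"]) simp
qed

text \<open>Induction along the homotopy, replacing the lift at each step while its endpoint
  \<open>u\<close> stays fixed.\<close>

lemma homotopic_lift:
  assumes "v \<in> Ob \<Omega>" "equivclp (zigzag_step \<Lambda>) (p v, w, y) z" "is_zigzag \<Lambda> (p v) w y"
    and "is_zigzag \<Omega> v W u" "zigzag_map p W = w"
  shows "\<exists>W'. is_zigzag \<Omega> v W' u \<and> zigzag_map p W' = fst (snd z)"
  using assms(2)
proof (induction rule: equivclp_induct)
  case base
  then show ?case using assms(4,5) by auto
next
  case (step z1 z2)
  obtain w1 where w1: "z1 = (p v, w1, y)" using homotopic_form[OF step.hyps(1) assms(3)] by blast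
  then obtain w2 where w2: "z2 = (p v, w2, y)" and zz: "is_zigzag \<Lambda> (p v) w1 y" "is_zigzag \<Lambda> (p v) w2 y"
    using zigzag_step_bi[of \<Lambda> "p v" w1 y z2] step.hyps(2) by blast
  obtain W1 where W1: "is_zigzag \<Omega> v W1 u" "zigzag_map p W1 = w1" using step.IH w1 by auto
  have "reduces \<Lambda> w1 w2 \<or> reduces \<Lambda> w2 w1"
    using step.hyps(2) unfolding w1 w2 by (auto elim: zigzag_step.cases)
  then have "\<exists>W2. is_zigzag \<Omega> v W2 u \<and> zigzag_map p W2 = w2"
  proof
    assume "reduces \<Lambda> w1 w2"
    then show ?thesis using reduces_lift[OF W1(1)] W1(2) by simp
  next
    \<comment> \<open>Here the reduction runs backwards. So \<open>w2\<close> is lifted first, with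
      an endpoint \<open>u2\<close> yet unknown; reducing this lift gives a lift of
      \<open>w1\<close>, and uniqueness yields \<open>u2 = u\<close>.\<close>
    assume r: "reduces \<Lambda> w2 w1"
    obtain W2 u2 where W2: "is_zigzag \<Omega> v W2 u2" "zigzag_map p W2 = w2"
      using zigzag_lift[OF assms(1) zz(2)] by blast
    then obtain W3 where "is_zigzag \<Omega> v W3 u2" "zigzag_map p W3 = w1"
      using reduces_lift r by metis
    then have "u2 = u" using zigzag_lift_unique W1 by metis
    then show ?thesis using W2 by blast
  qed
  then show ?case using w2 by simp
qed

text \<open>Following the homotopy turns \<open>W\<close> into a lift of the image of
  \<open>W'\<close> that still ends at \<open>u\<close>; by unique lifting it ends where
  \<open>W'\<close> does.\<close>

lemma homotopic_lift_endpoint: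
  assumes "is_zigzag \<Omega> v W u" "is_zigzag \<Omega> v W' u'"
    and "zigzag_class \<Lambda> (p v, zigzag_map p W, y) = zigzag_class \<Lambda> (p v, zigzag_map p W', y)" "y = p u"
  shows "u = u'"
proof -
  have "v \<in> Ob \<Omega>" using total.is_zigzag_Ob assms(1) by blast
  then obtain V where "is_zigzag \<Omega> v V u" "zigzag_map p V = zigzag_map p W'"
    using homotopic_lift[OF _ zigzag_class_eqD[OF assms(3)]] is_zigzag_map[OF assms(1)] assms by force
  then show ?thesis using zigzag_lift_unique assms(2) by blast
qed

end

section \<open>Morphisms out of a covering with null loops\<close>

lemma kgraph_covering_morphism:
  assumes "connected_covering k \<Lambda> \<Omega> p" "v \<in> Ob \<Omega>" "null_loops \<Lambda> \<Omega> p v" "covering k \<Lambda> \<Sigma> q"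
  shows "\<exists>\<phi>. covering_morphism k \<Omega> p \<Sigma> q \<phi>"
proof -
  interpret p: kgraph_covering k \<Lambda> \<Omega> p
    using assms(1) by unfold_locales (simp add: connected_covering_def)
  interpret q: kgraph_covering k \<Lambda> \<Sigma> q by unfold_locales (rule assms(4))
  obtain u where u: "u \<in> Ob \<Sigma>" "q u = p v" using q.vertex_lift[OF p.map_Ob[OF assms(2)]] by blast
  \<comment> \<open>The graph of the vertex map: equality of the images makes \<open>Z\<close> the
    \<open>q\<close>-lift at \<open>u\<close> of the image of \<open>W\<close>. Working with a
    relation avoids choosing \<open>W\<close>.\<close>
  define R where "R y z \<longleftrightarrow> (\<exists>W Z. is_zigzag \<Omega> v W y \<and> is_zigzag \<Sigma> u Z z \<and>
      zigzag_map p W = zigzag_map q Z \<and> p y = q z)" for y z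
  have R_unique: "z = z'" if R: "R y z" "R y z'" for y z z'
  proof -
    obtain W Z where 1: "is_zigzag \<Omega> v W y" "is_zigzag \<Sigma> u Z z" "zigzag_map p W = zigzag_map q Z" "p y = q z"
      using R(1) unfolding R_def by blast
    obtain W' Z' where 2: "is_zigzag \<Omega> v W' y" "is_zigzag \<Sigma> u Z' z'" "zigzag_map p W' = zigzag_map q Z'"
      using R(2) unfolding R_def by blast
    \<comment> \<open>Null loops make the images of \<open>W\<close> and \<open>W'\<close> homotopic
      in \<Lambda>, and homotopic words have \<open>q\<close>-lifts with the same endpoint.\<close>
    show ?thesis
      using q.homotopic_lift_endpoint[OF 1(2) 2(2)]
        null_loops_paths[OF p.cat_functor_axioms assms(3) 1(1) 2(1)] 1 2 u(2) by metis
  qed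
  have R_ex: "\<exists>z. R y z" if y: "y \<in> Ob \<Omega>" for y
  proof -
    obtain W where W: "is_zigzag \<Omega> v W y"
      using p.total.connected_cat_zigzag assms(1,2) y by (auto simp: connected_covering_def)
    then have w: "is_zigzag \<Lambda> (q u) (zigzag_map p W) (p y)" using p.is_zigzag_map u by metis
    then obtain Z z where Z: "is_zigzag \<Sigma> u Z z" "zigzag_map q Z = zigzag_map p W"
      using q.zigzag_lift[OF u(1)] by blast
    then have "p y = q z" using p.base.is_zigzag_endpoint[OF w] q.is_zigzag_map[OF Z(1)] by simp
    then show ?thesis using W Z unfolding R_def by metis
  qed
  have R_Ob: "y \<in> Ob \<Omega> \<and> z \<in> Ob \<Sigma> \<and> p y = q z" if "R y z" for y z
    using that p.total.is_zigzag_Ob q.total.is_zigzag_Ob unfolding R_def by blast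
  \<comment> \<open>The graph of the arrow map: an arrow goes to the \<open>q\<close>-lift of its
    image at the range prescribed by \<open>R\<close>.\<close>
  define S where "S \<alpha> \<beta> \<longleftrightarrow> \<alpha> \<in> Arr \<Omega> \<and> \<beta> \<in> Arr \<Sigma> \<and> p \<alpha> = q \<beta> \<and> R (Rng \<Omega> \<alpha>) (Rng \<Sigma> \<beta>)" for \<alpha> \<beta>
  have S_unique: "\<beta> = \<beta>'" if "S \<alpha> \<beta>" "S \<alpha> \<beta>'" for \<alpha> \<beta> \<beta>'
    using that R_unique q.lift_rng_unique[of \<beta> \<beta>'] unfolding S_def by metis
  have S_ex: "\<exists>\<beta>. S \<alpha> \<beta>" if \<alpha>: "\<alpha> \<in> Arr \<Omega>" for \<alpha>
  proof -
    obtain z where z: "R (Rng \<Omega> \<alpha>) z" using R_ex p.total.rng_Ob[OF \<alpha>] by blast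
    then have "z \<in> Ob \<Sigma>" "Rng \<Lambda> (p \<alpha>) = q z" using R_Ob p.map_rng[OF \<alpha>] by auto
    then obtain \<beta> where "\<beta> \<in> Arr \<Sigma>" "Rng \<Sigma> \<beta> = z" "q \<beta> = p \<alpha>"
      using q.lift_rng p.map_closed[OF \<alpha>] by metis
    then show ?thesis using z \<alpha> unfolding S_def by metis
  qed
  have S_vertex: "S y z" if "R y z" for y z
    using R_Ob[OF that] that p.total.Ob_iff q.total.Ob_iff unfolding S_def by metis
  have S_src: "R (Src \<Omega> \<alpha>) (Src \<Sigma> \<beta>)" if S: "S \<alpha> \<beta>" for \<alpha> \<beta>
  proof -
    have ab: "\<alpha> \<in> Arr \<Omega>" "\<beta> \<in> Arr \<Sigma>" "p \<alpha> = q \<beta>" using S S_def by auto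
    obtain W Z where "is_zigzag \<Omega> v W (Rng \<Omega> \<alpha>)" "is_zigzag \<Sigma> u Z (Rng \<Sigma> \<beta>)" "zigzag_map p W = zigzag_map q Z"
      using S S_def R_def by auto
    \<comment> \<open>The zigzags witnessing \<open>R\<close> at the ranges, extended by the letters
      of \<alpha> and \<beta>, witness \<open>R\<close> at the sources.\<close>
    then have "is_zigzag \<Omega> v (W @ [(\<alpha>, True)]) (Src \<Omega> \<alpha>)" "is_zigzag \<Sigma> u (Z @ [(\<beta>, True)]) (Src \<Sigma> \<beta>)"
      "zigzag_map p (W @ [(\<alpha>, True)]) = zigzag_map q (Z @ [(\<beta>, True)])"
      using ab is_zigzag_append[OF _ p.total.is_zigzag_letter] is_zigzag_append[OF _ q.total.is_zigzag_letter]
      by auto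
    moreover have "p (Src \<Omega> \<alpha>) = q (Src \<Sigma> \<beta>)" using ab by (simp add: p.map_src q.map_src)
    ultimately show ?thesis unfolding R_def by blast
  qed
  define \<phi> where "\<phi> \<alpha> = (THE \<beta>. S \<alpha> \<beta>)" for \<alpha>
  have S_\<phi>: "S \<alpha> (\<phi> \<alpha>)" if "\<alpha> \<in> Arr \<Omega>" for \<alpha>
    unfolding \<phi>_def by (rule theI') (use S_ex[OF that] S_unique in blast)
  have \<phi>_eq: "\<phi> \<alpha> = \<beta>" if "S \<alpha> \<beta>" for \<alpha> \<beta>
    using S_unique[OF S_\<phi> that] that unfolding S_def by blast
  have func: "cat_functor \<Omega> \<Sigma> \<phi>"
  proof
    fix \<alpha> assume \<alpha>: "\<alpha> \<in> Arr \<Omega>"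
    note S = S_\<phi>[OF \<alpha>]
    show "\<phi> \<alpha> \<in> Arr \<Sigma>" using S S_def by blast
    show "\<phi> (Src \<Omega> \<alpha>) = Src \<Sigma> (\<phi> \<alpha>)" by (rule \<phi>_eq[OF S_vertex[OF S_src[OF S]]])
    show "\<phi> (Rng \<Omega> \<alpha>) = Rng \<Sigma> (\<phi> \<alpha>)" using \<phi>_eq[OF S_vertex] S S_def by blast
  next
    fix \<alpha> \<beta> assume ab: "\<alpha> \<in> Arr \<Omega>" "\<beta> \<in> Arr \<Omega>" "Src \<Omega> \<alpha> = Rng \<Omega> \<beta>"
    note S = S_\<phi>[OF ab(1)] S_\<phi>[OF ab(2)]
    have arr: "\<phi> \<alpha> \<in> Arr \<Sigma>" "\<phi> \<beta> \<in> Arr \<Sigma>" and pq: "p \<alpha> = q (\<phi> \<alpha>)" "p \<beta> = q (\<phi> \<beta>)"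
      and R: "R (Rng \<Omega> \<alpha>) (Rng \<Sigma> (\<phi> \<alpha>))" "R (Rng \<Omega> \<beta>) (Rng \<Sigma> (\<phi> \<beta>))"
      using S S_def by auto
    \<comment> \<open>Both vertices are related by \<open>R\<close> to the common vertex
      \<open>Src \<Omega> \<alpha> = Rng \<Omega> \<beta>\<close>.\<close>
    have comp: "Src \<Sigma> (\<phi> \<alpha>) = Rng \<Sigma> (\<phi> \<beta>)"
      using R_unique[OF S_src[OF S(1)]] R(2) ab(3) by simp
    have "S (Cmp \<Omega> \<alpha> \<beta>) (Cmp \<Sigma> (\<phi> \<alpha>) (\<phi> \<beta>))"
      unfolding S_def using ab arr comp pq R(1) p.map_cmp[OF ab] q.map_cmp[OF arr comp]
      by (simp add: p.total.cmp_closed q.total.cmp_closed p.total.rng_cmp q.total.rng_cmp)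
    then show "\<phi> (Cmp \<Omega> \<alpha> \<beta>) = Cmp \<Sigma> (\<phi> \<alpha>) (\<phi> \<beta>)" by (rule \<phi>_eq)
  qed
  have over: "q (\<phi> \<alpha>) = p \<alpha>" "\<phi> \<alpha> \<in> Arr \<Sigma>" if "\<alpha> \<in> Arr \<Omega>" for \<alpha> using S_\<phi>[OF that] S_def by auto
  have "covering_morphism k \<Omega> p \<Sigma> q \<phi>"
    unfolding covering_morphism_def kgraph_morphism_def
    using func over p.total.k_graph_axioms q.total.k_graph_axioms p.deg_map q.deg_map by metis
  then show ?thesis by blast
qed

section \<open>The covering by homotopy classes of zigzags\<close>

text \<open>The \<open>k\<close>-graph structure on pairs of a class \<open>g\<close> of zigzags with range \<open>x\<close> and an arrow \<open>\<alpha>\<close> with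
  range the source of \<open>g\<close>.  The injection \<open>e\<close> only serves to move the pairs to a prescribed type.\<close>

definition based_arrows :: "('a, 'm) cat_scheme \<Rightarrow> 'a \<Rightarrow> ('a zigzag set \<times> 'a) set" where
  "based_arrows C x = {(zigzag_class C (x, w, Rng C \<alpha>), \<alpha>) |w \<alpha>. \<alpha> \<in> Arr C \<and> is_zigzag C x w (Rng C \<alpha>)}"

definition path_proj :: "('a, 'm) cat_scheme \<Rightarrow> 'a \<Rightarrow> ('a zigzag set \<times> 'a \<Rightarrow> 'c) \<Rightarrow> 'c \<Rightarrow> 'a" where
  "path_proj C x e a = snd (inv_into (based_arrows C x) e a)"

definition path_kgraph :: "'a kgraph \<Rightarrow> 'a \<Rightarrow> ('a zigzag set \<times> 'a \<Rightarrow> 'c) \<Rightarrow> 'c kgraph" where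
  "path_kgraph \<Lambda> x e =
     \<lparr>Arr = e ` based_arrows \<Lambda> x,
      Src = (\<lambda>a. case inv_into (based_arrows \<Lambda> x) e a of (g, \<alpha>) \<Rightarrow>
               e (Cmp (fundamental_groupoid \<Lambda>) g (groupoid_incl \<Lambda> \<alpha>), Src \<Lambda> \<alpha>)),
      Rng = (\<lambda>a. case inv_into (based_arrows \<Lambda> x) e a of (g, \<alpha>) \<Rightarrow> e (g, Rng \<Lambda> \<alpha>)),
      Cmp = (\<lambda>a b. case inv_into (based_arrows \<Lambda> x) e a of (g, \<alpha>) \<Rightarrow> e (g, Cmp \<Lambda> \<alpha> (path_proj \<Lambda> x e b))),
      Deg = (\<lambda>a. Deg \<Lambda> (path_proj \<Lambda> x e a))\<rparr>"

locale path_covering = k_graph k \<Lambda>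
  for k :: nat and \<Lambda> :: "'a kgraph" +
  fixes x :: 'a and e :: "'a zigzag set \<times> 'a \<Rightarrow> 'c"
  assumes connected: "connected_cat \<Lambda>" and x: "x \<in> Ob \<Lambda>" and inj: "inj_on e (based_arrows \<Lambda> x)"
begin

definition total_kgraph :: "'c kgraph" ("\<Omega>") where "\<Omega> = path_kgraph \<Lambda> x e"

definition proj :: "'c \<Rightarrow> 'a" ("\<p>") where "\<p> = path_proj \<Lambda> x e"

section \<open>Naming the arrows of \<Omega> by words\<close>

definition based :: "'a letter list \<Rightarrow> 'a \<Rightarrow> bool" where
  "based w \<alpha> \<longleftrightarrow> \<alpha> \<in> Arr \<Lambda> \<and> is_zigzag \<Lambda> x w (Rng \<Lambda> \<alpha>)"

text \<open>Names use words instead of classes, so that sources, ranges and composites are computed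
  on words; \<open>arrow_eq_iff\<close> says when two names agree.\<close>

definition arrow :: "'a letter list \<Rightarrow> 'a \<Rightarrow> 'c" where
  "arrow w \<alpha> = e (zigzag_class \<Lambda> (x, w, Rng \<Lambda> \<alpha>), \<alpha>)"

lemma based_vertex: "y \<in> Ob \<Lambda> \<Longrightarrow> based w y \<longleftrightarrow> is_zigzag \<Lambda> x w y"
  by (auto simp: based_def Ob_iff)

lemma class_append:
  assumes "zigzag_class \<Lambda> (x, w, y) = zigzag_class \<Lambda> (x, w', y)"
    "is_zigzag \<Lambda> x w y" "is_zigzag \<Lambda> x w' y" "is_zigzag \<Lambda> y u z"
  shows "zigzag_class \<Lambda> (x, w @ u, z) = zigzag_class \<Lambda> (x, w' @ u, z)"
  using Cmp_fundamental_groupoid[OF assms(2,4)] Cmp_fundamental_groupoid[OF assms(3,4)] assms(1) by simp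

lemma class_cancel:
  assumes "is_zigzag \<Lambda> x w y" "\<alpha> \<in> Arr \<Lambda>" "letter_rng \<Lambda> (\<alpha>, b) = y"
  shows "zigzag_class \<Lambda> (x, w @ [(\<alpha>, b), (\<alpha>, \<not> b)], y) = zigzag_class \<Lambda> (x, w, y)"
proof -
  have "is_zigzag \<Lambda> y [(\<alpha>, b), (\<alpha>, \<not> b)] y"
    using assms by (auto simp: letter_rng_def letter_src_def rng_Ob src_Ob)
  then show ?thesis
    using zigzag_class_reduces[OF is_zigzag_append[OF assms(1)] assms(1)] reduces.cancel[of \<Lambda> w \<alpha> b "[]"]
    by (metis append_Nil2)
qed

lemma class_Cmp:
  assumes "is_zigzag \<Lambda> x w (Rng \<Lambda> \<alpha>)" "\<alpha> \<in> Arr \<Lambda>" "\<beta> \<in> Arr \<Lambda>" "Src \<Lambda> \<alpha> = Rng \<Lambda> \<beta>"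
  shows "zigzag_class \<Lambda> (x, w @ [(Cmp \<Lambda> \<alpha> \<beta>, True)], Src \<Lambda> \<beta>) =
    zigzag_class \<Lambda> (x, w @ [(\<alpha>, True), (\<beta>, True)], Src \<Lambda> \<beta>)"
proof -
  have z: "is_zigzag \<Lambda> (Rng \<Lambda> \<alpha>) [(\<alpha>, True), (\<beta>, True)] (Src \<Lambda> \<beta>)"
    "is_zigzag \<Lambda> (Rng \<Lambda> \<alpha>) [(Cmp \<Lambda> \<alpha> \<beta>, True)] (Src \<Lambda> \<beta>)"
    using assms by (auto simp: letter_rng_def letter_src_def src_Ob cmp_closed rng_cmp src_cmp)
  then show ?thesis
    using zigzag_class_reduces[OF is_zigzag_append[OF assms(1) z(1)] is_zigzag_append[OF assms(1) z(2)]]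
      reduces.compose[of \<Lambda> \<alpha> \<beta> w "[]"] assms(4) by (metis append_Nil2)
qed

lemma based_extend: "based w \<alpha> \<Longrightarrow> is_zigzag \<Lambda> x (w @ [(\<alpha>, True)]) (Src \<Lambda> \<alpha>)"
  using is_zigzag_append is_zigzag_letter by (fastforce simp: based_def)

lemma based_src: "based w \<alpha> \<Longrightarrow> based (w @ [(\<alpha>, True)]) (Src \<Lambda> \<alpha>)"
  using based_extend[of w \<alpha>] by (simp add: based_vertex src_Ob based_def[of w])

lemma based_rng: "based w \<alpha> \<Longrightarrow> based w (Rng \<Lambda> \<alpha>)"
  by (simp add: based_def rng_closed rng_rng)

lemma based_cmp:
  "\<lbrakk>based w \<alpha>; \<beta> \<in> Arr \<Lambda>; Src \<Lambda> \<alpha> = Rng \<Lambda> \<beta>\<rbrakk> \<Longrightarrow> based w (Cmp \<Lambda> \<alpha> \<beta>)"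
  by (simp add: based_def cmp_closed rng_cmp)

lemma Arr_total: "a \<in> Arr \<Omega> \<longleftrightarrow> (\<exists>w \<alpha>. based w \<alpha> \<and> a = arrow w \<alpha>)"
  by (auto simp: total_kgraph_def path_kgraph_def based_arrows_def arrow_def based_def)

lemma arrow_eq_iff:
  assumes "based w \<alpha>" "based w' \<beta>"
  shows "arrow w \<alpha> = arrow w' \<beta> \<longleftrightarrow>
    \<alpha> = \<beta> \<and> zigzag_class \<Lambda> (x, w, Rng \<Lambda> \<alpha>) = zigzag_class \<Lambda> (x, w', Rng \<Lambda> \<alpha>)"
proof -
  have "(zigzag_class \<Lambda> (x, w, Rng \<Lambda> \<alpha>), \<alpha>) \<in> based_arrows \<Lambda> x"
    "(zigzag_class \<Lambda> (x, w', Rng \<Lambda> \<beta>), \<beta>) \<in> based_arrows \<Lambda> x"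
    using assms by (auto simp: based_arrows_def based_def)
  then show ?thesis using inj_on_eq_iff[OF inj] by (auto simp: arrow_def)
qed

lemma decode_arrow:
  assumes "based w \<alpha>"
  shows "inv_into (based_arrows \<Lambda> x) e (arrow w \<alpha>) = (zigzag_class \<Lambda> (x, w, Rng \<Lambda> \<alpha>), \<alpha>)"
  unfolding arrow_def
  by (rule inv_into_f_f[OF inj]) (use assms in \<open>auto simp: based_arrows_def based_def\<close>)

lemma proj_arrow: "based w \<alpha> \<Longrightarrow> \<p> (arrow w \<alpha>) = \<alpha>"
  by (simp add: proj_def path_proj_def decode_arrow)

lemma Rng_arrow: "based w \<alpha> \<Longrightarrow> Rng \<Omega> (arrow w \<alpha>) = arrow w (Rng \<Lambda> \<alpha>)"
  by (simp add: total_kgraph_def path_kgraph_def decode_arrow)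
    (simp add: arrow_def based_def rng_rng)

lemma Src_arrow:
  assumes "based w \<alpha>" shows "Src \<Omega> (arrow w \<alpha>) = arrow (w @ [(\<alpha>, True)]) (Src \<Lambda> \<alpha>)"
proof -
  have "Cmp (fundamental_groupoid \<Lambda>) (zigzag_class \<Lambda> (x, w, Rng \<Lambda> \<alpha>)) (groupoid_incl \<Lambda> \<alpha>) =
      zigzag_class \<Lambda> (x, w @ [(\<alpha>, True)], Src \<Lambda> \<alpha>)"
    unfolding groupoid_incl_def
    using assms by (intro Cmp_fundamental_groupoid is_zigzag_letter) (auto simp: based_def)
  then show ?thesis
    using assms by (simp add: total_kgraph_def path_kgraph_def decode_arrow)
      (simp add: arrow_def based_def rng_src)
qed

text \<open>The composite takes its class from the first factor: for a composable pair the class of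
  the second is that of \<open>w @ [(\<alpha>, True)]\<close>, as \<open>composableE\<close>
  shows.\<close>

lemma Cmp_arrow:
  "\<lbrakk>based w \<alpha>; based w' \<beta>; Src \<Lambda> \<alpha> = Rng \<Lambda> \<beta>\<rbrakk> \<Longrightarrow> Cmp \<Omega> (arrow w \<alpha>) (arrow w' \<beta>) = arrow w (Cmp \<Lambda> \<alpha> \<beta>)"
  by (simp add: total_kgraph_def path_kgraph_def decode_arrow path_proj_def)
    (simp add: arrow_def based_def rng_cmp)

lemma Deg_arrow: "based w \<alpha> \<Longrightarrow> Deg \<Omega> (arrow w \<alpha>) = Deg \<Lambda> \<alpha>"
  by (simp add: total_kgraph_def path_kgraph_def decode_arrow path_proj_def)

text \<open>Composability says that the word naming \<open>b\<close> is homotopic to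
  \<open>w @ [(\<alpha>, True)]\<close>, so \<open>b\<close> can be renamed by the latter. Later
  arguments about composites use such matching names.\<close>

lemma composableE:
  assumes "a \<in> Arr \<Omega>" "b \<in> Arr \<Omega>" "Src \<Omega> a = Rng \<Omega> b"
  obtains w \<alpha> \<beta> where "a = arrow w \<alpha>" "b = arrow (w @ [(\<alpha>, True)]) \<beta>" "based w \<alpha>"
    "based (w @ [(\<alpha>, True)]) \<beta>" "\<beta> \<in> Arr \<Lambda>" "Src \<Lambda> \<alpha> = Rng \<Lambda> \<beta>"
proof -
  obtain w \<alpha> w' \<beta> where ab: "a = arrow w \<alpha>" "b = arrow w' \<beta>" "based w \<alpha>" "based w' \<beta>"
    using assms(1,2) Arr_total by metis
  have "arrow (w @ [(\<alpha>, True)]) (Src \<Lambda> \<alpha>) = arrow w' (Rng \<Lambda> \<beta>)"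
    using assms(3) ab Src_arrow Rng_arrow by simp
  then have eq: "Src \<Lambda> \<alpha> = Rng \<Lambda> \<beta>"
    "zigzag_class \<Lambda> (x, w @ [(\<alpha>, True)], Rng \<Lambda> \<beta>) = zigzag_class \<Lambda> (x, w', Rng \<Lambda> \<beta>)"
    using arrow_eq_iff[OF based_src[OF ab(3)] based_rng[OF ab(4)]] ab(3,4)
    by (auto simp: based_def rng_rng)
  have b: "based (w @ [(\<alpha>, True)]) \<beta>" using based_extend[OF ab(3)] eq(1) ab(4) by (simp add: based_def)
  then have "b = arrow (w @ [(\<alpha>, True)]) \<beta>" using arrow_eq_iff[OF b ab(4)] eq(2) ab(2) by simp
  then show thesis using that ab b eq(1) by (simp add: based_def)
qed

section \<open>The \<open>k\<close>-graph structure of \<Omega>\<close>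

lemma category_total: "category \<Omega>"
proof
  fix a assume "a \<in> Arr \<Omega>"
  then obtain w \<alpha> where a: "a = arrow w \<alpha>" "based w \<alpha>" using Arr_total by metis
  have \<alpha>: "\<alpha> \<in> Arr \<Lambda>" using a by (simp add: based_def)
  note simps = a(1) Src_arrow[OF a(2)] Rng_arrow[OF a(2)] Src_arrow[OF based_src[OF a(2)]]
    Src_arrow[OF based_rng[OF a(2)]] Rng_arrow[OF based_src[OF a(2)]] Rng_arrow[OF based_rng[OF a(2)]]
  show "Src \<Omega> a \<in> Arr \<Omega>" "Rng \<Omega> a \<in> Arr \<Omega>"
    unfolding Arr_total using simps based_src[OF a(2)] based_rng[OF a(2)] by auto
  \<comment> \<open>\<open>Src_arrow\<close> appends a letter even at a vertex. The letter of a
    vertex is an identity of the groupoid, so the class stays the same; this gives the laws for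
    iterated \<open>Src\<close> and \<open>Rng\<close>.\<close>
  have id: "arrow (u @ [(y, True)]) y = arrow u y" if "y \<in> Ob \<Lambda>" "is_zigzag \<Lambda> x u y" for u y
  proof -
    have y: "y \<in> Arr \<Lambda>" "Src \<Lambda> y = y" "Rng \<Lambda> y = y" using that Ob_iff by auto
    have z: "is_zigzag \<Lambda> y [(y, True)] y" "is_zigzag \<Lambda> y [] y"
      using is_zigzag_letter[OF y(1)] y that(1) by simp_all
    show ?thesis
      using Cmp_fundamental_groupoid[OF that(2) z(1)] Cmp_fundamental_groupoid[OF that(2) z(2)]
        groupoid_incl_vertex[OF that(1)] y by (simp add: arrow_def groupoid_incl_def)
  qed
  show "Src \<Omega> (Src \<Omega> a) = Src \<Omega> a" "Rng \<Omega> (Src \<Omega> a) = Src \<Omega> a"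
    "Src \<Omega> (Rng \<Omega> a) = Rng \<Omega> a" "Rng \<Omega> (Rng \<Omega> a) = Rng \<Omega> a"
    using id[OF src_Ob[OF \<alpha>] based_extend[OF a(2)]] id[OF rng_Ob[OF \<alpha>], of w] a(2)
    by (simp_all add: simps src_src[OF \<alpha>] rng_src[OF \<alpha>] src_rng[OF \<alpha>] rng_rng[OF \<alpha>] based_def)
  show "Cmp \<Omega> a (Src \<Omega> a) = a"
    using Cmp_arrow[OF a(2) based_src[OF a(2)]] by (simp add: simps rng_src[OF \<alpha>] cmp_src[OF \<alpha>])
  show "Cmp \<Omega> (Rng \<Omega> a) a = a"
    using Cmp_arrow[OF based_rng[OF a(2)] a(2)] by (simp add: simps src_rng[OF \<alpha>] rng_cmp_id[OF \<alpha>])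
next
  fix a b assume "a \<in> Arr \<Omega>" "b \<in> Arr \<Omega>" "Src \<Omega> a = Rng \<Omega> b"
  then obtain w \<alpha> \<beta> where ab: "a = arrow w \<alpha>" "b = arrow (w @ [(\<alpha>, True)]) \<beta>" "based w \<alpha>"
    "based (w @ [(\<alpha>, True)]) \<beta>" "\<beta> \<in> Arr \<Lambda>" "Src \<Lambda> \<alpha> = Rng \<Lambda> \<beta>"
    by (rule composableE)
  have \<alpha>: "\<alpha> \<in> Arr \<Lambda>" "is_zigzag \<Lambda> x w (Rng \<Lambda> \<alpha>)" using ab by (auto simp: based_def)
  note c = Cmp_arrow[OF ab(3,4,6)] based_cmp[OF ab(3,5,6)]
  show "Cmp \<Omega> a b \<in> Arr \<Omega>" unfolding Arr_total using ab c by auto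
  \<comment> \<open>The source of the composite and the source of \<open>b\<close> have names that
    differ by one composition step.\<close>
  have "arrow (w @ [(Cmp \<Lambda> \<alpha> \<beta>, True)]) (Src \<Lambda> \<beta>) = arrow (w @ [(\<alpha>, True), (\<beta>, True)]) (Src \<Lambda> \<beta>)"
    using class_Cmp[OF \<alpha>(2,1) ab(5,6)] by (simp add: arrow_def rng_src[OF ab(5)])
  then show "Src \<Omega> (Cmp \<Omega> a b) = Src \<Omega> b"
    using ab c by (simp add: Src_arrow src_cmp[OF \<alpha>(1) ab(5,6)])
  show "Rng \<Omega> (Cmp \<Omega> a b) = Rng \<Omega> a"
    using ab c by (simp add: Rng_arrow rng_cmp[OF \<alpha>(1) ab(5,6)])
next
  fix a b c assume abc: "a \<in> Arr \<Omega>" "b \<in> Arr \<Omega>" "c \<in> Arr \<Omega>" "Src \<Omega> a = Rng \<Omega> b" "Src \<Omega> b = Rng \<Omega> c"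
  obtain w \<alpha> \<beta> where ab: "a = arrow w \<alpha>" "b = arrow (w @ [(\<alpha>, True)]) \<beta>" "based w \<alpha>"
    "based (w @ [(\<alpha>, True)]) \<beta>" "\<beta> \<in> Arr \<Lambda>" "Src \<Lambda> \<alpha> = Rng \<Lambda> \<beta>"
    by (rule composableE[OF abc(1,2,4)])
  obtain u \<beta>' \<gamma> where bc: "b = arrow u \<beta>'" "c = arrow (u @ [(\<beta>', True)]) \<gamma>" "based u \<beta>'"
    "based (u @ [(\<beta>', True)]) \<gamma>" "\<gamma> \<in> Arr \<Lambda>" "Src \<Lambda> \<beta>' = Rng \<Lambda> \<gamma>"
    by (rule composableE[OF abc(2,3,5)])
  \<comment> \<open>The arrow \<open>b\<close> has two names, one from each pair; their words may
    differ, but not their underlying arrows.\<close>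
  have \<beta>: "\<beta>' = \<beta>" using ab bc arrow_eq_iff by metis
  have \<alpha>: "\<alpha> \<in> Arr \<Lambda>" using ab by (simp add: based_def)
  note bc' = bc(2-6)[unfolded \<beta>]
  have "Cmp \<Omega> (Cmp \<Omega> a b) c = arrow w (Cmp \<Lambda> (Cmp \<Lambda> \<alpha> \<beta>) \<gamma>)"
    using Cmp_arrow[OF ab(3,4,6)] Cmp_arrow[OF based_cmp[OF ab(3,5,6)] bc'(3)] ab bc'
    by (simp add: src_cmp[OF \<alpha> ab(5,6)])
  moreover have "Cmp \<Omega> a (Cmp \<Omega> b c) = arrow w (Cmp \<Lambda> \<alpha> (Cmp \<Lambda> \<beta> \<gamma>))"
    using Cmp_arrow[OF ab(4) bc'(3,5)] Cmp_arrow[OF ab(3) based_cmp[OF ab(4) bc'(4,5)]] ab bc'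
    by (simp add: rng_cmp[OF ab(5) bc'(4,5)])
  ultimately show "Cmp \<Omega> (Cmp \<Omega> a b) c = Cmp \<Omega> a (Cmp \<Omega> b c)"
    using cmp_assoc[OF \<alpha> ab(5) bc'(4) ab(6) bc'(5)] by simp
qed

lemma ObE:
  assumes "v \<in> Ob \<Omega>"
  obtains w y where "v = arrow w y" "y \<in> Ob \<Lambda>" "is_zigzag \<Lambda> x w y" "based w y"
proof -
  obtain w y where v: "v = arrow w y" "based w y" using assms Arr_total unfolding Ob_def by auto
  have "arrow (w @ [(y, True)]) (Src \<Lambda> y) = arrow w y"
    using assms v Src_arrow by (simp add: Ob_def)
  then have "y \<in> Ob \<Lambda>" using arrow_eq_iff[OF based_src[OF v(2)] v(2)] v(2) by (simp add: Ob_def based_def)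
  then show thesis using that v based_vertex by metis
qed

lemma k_graph_total: "k_graph k \<Omega>"
proof -
  interpret total: category \<Omega> by (rule category_total)
  show ?thesis
  proof
    have "based [] x" using x by (simp add: based_vertex)
    then show "Arr \<Omega> \<noteq> {}" using Arr_total by blast
    show "Deg \<Omega> a \<in> degrees k" if "a \<in> Arr \<Omega>" for a
      using that deg_closed unfolding Arr_total by (auto simp: Deg_arrow) (simp add: based_def)
    show "Deg \<Omega> v = (\<lambda>i. 0)" if "v \<in> Ob \<Omega>" for v
      using that deg_vertex by (metis ObE Deg_arrow)
  next
    fix a b assume "a \<in> Arr \<Omega>" "b \<in> Arr \<Omega>" "Src \<Omega> a = Rng \<Omega> b"
    then obtain w \<alpha> \<beta> where ab: "a = arrow w \<alpha>" "b = arrow (w @ [(\<alpha>, True)]) \<beta>" "based w \<alpha>"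
      "based (w @ [(\<alpha>, True)]) \<beta>" "\<beta> \<in> Arr \<Lambda>" "Src \<Lambda> \<alpha> = Rng \<Lambda> \<beta>"
      by (rule composableE)
    then have "\<alpha> \<in> Arr \<Lambda>" by (simp add: based_def)
    then show "Deg \<Omega> (Cmp \<Omega> a b) = (\<lambda>i. Deg \<Omega> a i + Deg \<Omega> b i)"
      using ab by (simp add: Cmp_arrow Deg_arrow based_cmp deg_cmp)
  next
    fix a n l assume a: "a \<in> Arr \<Omega>" and n: "n \<in> degrees k" "l \<in> degrees k" and
      deg: "Deg \<Omega> a = (\<lambda>i. n i + l i)"
    obtain w \<alpha> where a: "a = arrow w \<alpha>" "based w \<alpha>" using a Arr_total by metis
    then have \<alpha>: "\<alpha> \<in> Arr \<Lambda>" "Deg \<Lambda> \<alpha> = (\<lambda>i. n i + l i)" using deg by (auto simp: Deg_arrow based_def)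
    note fac = factorization[OF \<alpha>(1) n \<alpha>(2)]
    obtain \<beta> \<gamma> where bc: "\<beta> \<in> Arr \<Lambda>" "\<gamma> \<in> Arr \<Lambda>" "Deg \<Lambda> \<beta> = n" "Deg \<Lambda> \<gamma> = l"
      "Src \<Lambda> \<beta> = Rng \<Lambda> \<gamma>" "\<alpha> = Cmp \<Lambda> \<beta> \<gamma>"
      using ex1_implies_ex[OF fac] by auto
    \<comment> \<open>The factorization of \<alpha> lifts: the first factor inherits
      \<open>w\<close>, the second is named by \<open>w\<close> extended by \<beta>.\<close>
    have \<beta>: "based w \<beta>" using a(2) bc by (simp add: based_def rng_cmp)
    have \<gamma>: "based (w @ [(\<beta>, True)]) \<gamma>" using based_extend[OF \<beta>] bc by (simp add: based_def)
    show "\<exists>!\<beta>\<gamma>. case \<beta>\<gamma> of (\<beta>, \<gamma>) \<Rightarrow> \<beta> \<in> Arr \<Omega> \<and> \<gamma> \<in> Arr \<Omega> \<and> Deg \<Omega> \<beta> = n \<and> Deg \<Omega> \<gamma> = l \<and>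
            Src \<Omega> \<beta> = Rng \<Omega> \<gamma> \<and> a = Cmp \<Omega> \<beta> \<gamma>"
    proof (rule ex1I[of _ "(arrow w \<beta>, arrow (w @ [(\<beta>, True)]) \<gamma>)"])
      have "arrow w \<beta> \<in> Arr \<Omega>" "arrow (w @ [(\<beta>, True)]) \<gamma> \<in> Arr \<Omega>"
        using \<beta> \<gamma> Arr_total by blast+
      then show "case (arrow w \<beta>, arrow (w @ [(\<beta>, True)]) \<gamma>) of (\<beta>, \<gamma>) \<Rightarrow> \<beta> \<in> Arr \<Omega> \<and> \<gamma> \<in> Arr \<Omega> \<and>
          Deg \<Omega> \<beta> = n \<and> Deg \<Omega> \<gamma> = l \<and> Src \<Omega> \<beta> = Rng \<Omega> \<gamma> \<and> a = Cmp \<Omega> \<beta> \<gamma>"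
        using \<beta> \<gamma> bc a by (simp add: Deg_arrow Src_arrow Rng_arrow Cmp_arrow)
    next
      fix z assume z: "case z of (\<beta>, \<gamma>) \<Rightarrow> \<beta> \<in> Arr \<Omega> \<and> \<gamma> \<in> Arr \<Omega> \<and>
          Deg \<Omega> \<beta> = n \<and> Deg \<Omega> \<gamma> = l \<and> Src \<Omega> \<beta> = Rng \<Omega> \<gamma> \<and> a = Cmp \<Omega> \<beta> \<gamma>"
      obtain b c where bc': "z = (b, c)" by fastforce
      then have z': "b \<in> Arr \<Omega>" "c \<in> Arr \<Omega>" "Deg \<Omega> b = n" "Deg \<Omega> c = l" "Src \<Omega> b = Rng \<Omega> c" "a = Cmp \<Omega> b c"
        using z by auto
      obtain w' \<beta>' \<gamma>' where d: "b = arrow w' \<beta>'" "c = arrow (w' @ [(\<beta>', True)]) \<gamma>'" "based w' \<beta>'"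
        "based (w' @ [(\<beta>', True)]) \<gamma>'" "\<gamma>' \<in> Arr \<Lambda>" "Src \<Lambda> \<beta>' = Rng \<Lambda> \<gamma>'"
        by (rule composableE[OF z'(1,2,5)])
      have \<beta>': "\<beta>' \<in> Arr \<Lambda>" using d by (simp add: based_def)
      have "arrow w \<alpha> = arrow w' (Cmp \<Lambda> \<beta>' \<gamma>')" using z'(6) a d by (simp add: Cmp_arrow)
      then have eq: "\<alpha> = Cmp \<Lambda> \<beta>' \<gamma>'"
        "zigzag_class \<Lambda> (x, w, Rng \<Lambda> \<alpha>) = zigzag_class \<Lambda> (x, w', Rng \<Lambda> \<alpha>)"
        using arrow_eq_iff[OF a(2) based_cmp[OF d(3,5,6)]] by blast+
      have deg': "Deg \<Lambda> \<beta>' = n" "Deg \<Lambda> \<gamma>' = l" using z' d by (simp_all add: Deg_arrow)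
      \<comment> \<open>Any factorization of \<open>a\<close> projects to one of \<alpha>, which
        fixes the underlying arrows; the classes then follow from \<open>eq\<close>.\<close>
      have "(\<beta>', \<gamma>') = (\<beta>, \<gamma>)"
        by (rule ex1E[OF fac]) (use bc d deg' eq \<beta>' in auto)
      then have e: "\<beta>' = \<beta>" "\<gamma>' = \<gamma>" by auto
      have r: "Rng \<Lambda> \<alpha> = Rng \<Lambda> \<beta>" using bc rng_cmp by simp
      have b: "b = arrow w \<beta>" using arrow_eq_iff[OF \<beta> d(3)[unfolded e]] d(1) eq(2) r e by simp
      have zz: "is_zigzag \<Lambda> x w (Rng \<Lambda> \<beta>)" "is_zigzag \<Lambda> x w' (Rng \<Lambda> \<beta>)"
        using \<beta> d(3) e by (simp_all add: based_def)
      have "zigzag_class \<Lambda> (x, w @ [(\<beta>, True)], Src \<Lambda> \<beta>) = zigzag_class \<Lambda> (x, w' @ [(\<beta>, True)], Src \<Lambda> \<beta>)"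
        by (rule class_append[OF _ zz is_zigzag_letter[OF bc(1)]]) (use eq r in simp)
      then have "c = arrow (w @ [(\<beta>, True)]) \<gamma>" using d(2) e bc(5) by (simp add: arrow_def)
      then show "z = (arrow w \<beta>, arrow (w @ [(\<beta>, True)]) \<gamma>)" using b bc' by simp
    qed
  qed
qed

section \<open>The projection as a covering\<close>

lemma functor_proj: "cat_functor \<Omega> \<Lambda> \<p>"
proof -
  interpret total: k_graph k \<Omega> by (rule k_graph_total)
  show ?thesis
  proof
    fix a assume "a \<in> Arr \<Omega>"
    then obtain w \<alpha> where a: "a = arrow w \<alpha>" "based w \<alpha>" using Arr_total by metis
    then show "\<p> a \<in> Arr \<Lambda>" by (simp add: proj_arrow) (simp add: based_def)
    show "\<p> (Src \<Omega> a) = Src \<Lambda> (\<p> a)" "\<p> (Rng \<Omega> a) = Rng \<Lambda> (\<p> a)"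
      using a by (simp_all add: proj_arrow Src_arrow Rng_arrow based_src based_rng)
  next
    fix a b assume "a \<in> Arr \<Omega>" "b \<in> Arr \<Omega>" "Src \<Omega> a = Rng \<Omega> b"
    then obtain w \<alpha> \<beta> where ab: "a = arrow w \<alpha>" "b = arrow (w @ [(\<alpha>, True)]) \<beta>" "based w \<alpha>"
      "based (w @ [(\<alpha>, True)]) \<beta>" "\<beta> \<in> Arr \<Lambda>" "Src \<Lambda> \<alpha> = Rng \<Lambda> \<beta>"
      by (rule composableE)
    then show "\<p> (Cmp \<Omega> a b) = Cmp \<Lambda> (\<p> a) (\<p> b)"
      by (simp add: Cmp_arrow proj_arrow based_cmp)
  qed
qed

text \<open>Appending the inverse letter undoes the last one. This gives injectivity of the
  projection on arrows with a common source.\<close>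

lemma arrow_cancel:
  assumes "based w \<alpha>" "based w' \<alpha>"
    "zigzag_class \<Lambda> (x, w @ [(\<alpha>, True)], Src \<Lambda> \<alpha>) = zigzag_class \<Lambda> (x, w' @ [(\<alpha>, True)], Src \<Lambda> \<alpha>)"
  shows "arrow w \<alpha> = arrow w' \<alpha>"
proof -
  have \<alpha>: "\<alpha> \<in> Arr \<Lambda>" using assms(1) by (simp add: based_def)
  have "zigzag_class \<Lambda> (x, u, Rng \<Lambda> \<alpha>) =
      zigzag_class \<Lambda> (x, (u @ [(\<alpha>, True)]) @ [(\<alpha>, False)], Rng \<Lambda> \<alpha>)" if "based u \<alpha>" for u
    using class_cancel[of u "Rng \<Lambda> \<alpha>" \<alpha> True] that by (simp add: based_def letter_rng_def)
  then show ?thesis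
    using class_append[OF assms(3) based_extend[OF assms(1)] based_extend[OF assms(2)] is_zigzag_letter_inv[OF \<alpha>]]
      assms arrow_eq_iff by metis
qed

text \<open>An arrow over \<alpha> with source the class of \<open>w\<close> has as range this class
  times the inverse of \<alpha>, which \<open>w @ [(\<alpha>, False)]\<close> represents.\<close>

lemma arrow_over_src:
  assumes "based w (Src \<Lambda> \<alpha>)" "\<alpha> \<in> Arr \<Lambda>"
  shows "based (w @ [(\<alpha>, False)]) \<alpha>" "Src \<Omega> (arrow (w @ [(\<alpha>, False)]) \<alpha>) = arrow w (Src \<Lambda> \<alpha>)"
proof -
  have w: "is_zigzag \<Lambda> x w (Src \<Lambda> \<alpha>)" using assms by (simp add: based_def rng_src)
  show b: "based (w @ [(\<alpha>, False)]) \<alpha>"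
    using is_zigzag_append[OF w is_zigzag_letter_inv[OF assms(2)]] assms(2) by (simp add: based_def)
  show "Src \<Omega> (arrow (w @ [(\<alpha>, False)]) \<alpha>) = arrow w (Src \<Lambda> \<alpha>)"
    using Src_arrow[OF b] class_cancel[OF w assms(2), of False] assms(2)
    by (simp add: arrow_def rng_src letter_rng_def)
qed

lemma covering_proj: "covering k \<Lambda> \<Omega> \<p>"
  unfolding covering_def kgraph_morphism_def
proof (intro conjI ballI)
  show "k_graph k \<Omega>" "k_graph k \<Lambda>" "cat_functor \<Omega> \<Lambda> \<p>"
    by (rule k_graph_total, rule k_graph_axioms, rule functor_proj)
  show "Deg \<Lambda> (\<p> a) = Deg \<Omega> a" if "a \<in> Arr \<Omega>" for a
    using that unfolding Arr_total by (auto simp: proj_arrow Deg_arrow)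
  show "\<p> ` Arr \<Omega> = Arr \<Lambda>"
  proof (intro equalityI subsetI)
    fix \<alpha> assume "\<alpha> \<in> \<p> ` Arr \<Omega>"
    then show "\<alpha> \<in> Arr \<Lambda>" using cat_functor.map_closed[OF functor_proj] by auto
  next
    fix \<alpha> assume \<alpha>: "\<alpha> \<in> Arr \<Lambda>"
    \<comment> \<open>Connectedness supplies a zigzag from \<open>x\<close> to the range of
      \<alpha>, and it names an arrow over \<alpha>.\<close>
    then obtain w where "based w \<alpha>"
      using connected_cat_zigzag[OF connected x rng_Ob[OF \<alpha>]] by (auto simp: based_def)
    then show "\<alpha> \<in> \<p> ` Arr \<Omega>" using proj_arrow Arr_total by (metis imageI)
  qed
next
  fix v assume "v \<in> Ob \<Omega>"
  then obtain u y where v: "v = arrow u y" "y \<in> Ob \<Lambda>" "is_zigzag \<Lambda> x u y" "based u y" by (rule ObE)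
  have y: "Rng \<Lambda> y = y" "Src \<Lambda> y = y" using v Ob_iff by auto
  have py: "\<p> v = y" using v proj_arrow by simp
  interpret proj: cat_functor \<Omega> \<Lambda> \<p> by (rule functor_proj)
  \<comment> \<open>At a fixed source, \<open>arrow_cancel\<close> gives injectivity and
    \<open>arrow_over_src\<close> gives preimages.\<close>
  show "bij_betw \<p> (arrows_from \<Omega> v) (arrows_from \<Lambda> (\<p> v))"
    unfolding py
  proof (rule bij_betwI')
    fix a b assume "a \<in> arrows_from \<Omega> v" "b \<in> arrows_from \<Omega> v"
    then obtain w \<alpha> w' \<beta> where ab: "a = arrow w \<alpha>" "based w \<alpha>" "b = arrow w' \<beta>" "based w' \<beta>"
      "Src \<Omega> a = Src \<Omega> b"
      unfolding arrows_from_def using Arr_total by auto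
    show "(\<p> a = \<p> b) = (a = b)"
    proof
      assume "\<p> a = \<p> b"
      then have "\<beta> = \<alpha>" using ab proj_arrow by simp
      note ab = ab[unfolded this]
      have "\<alpha> \<in> Arr \<Lambda>" using ab by (simp add: based_def)
      then have "zigzag_class \<Lambda> (x, w @ [(\<alpha>, True)], Src \<Lambda> \<alpha>) = zigzag_class \<Lambda> (x, w' @ [(\<alpha>, True)], Src \<Lambda> \<alpha>)"
        using ab(5) arrow_eq_iff[OF based_src[OF ab(2)] based_src[OF ab(4)]]
        unfolding ab(1,3) Src_arrow[OF ab(2)] Src_arrow[OF ab(4)] by (simp add: rng_src)
      then show "a = b" using arrow_cancel[OF ab(2,4)] ab(1,3) by simp
    qed simp
  next
    fix a assume "a \<in> arrows_from \<Omega> v"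
    then have a: "a \<in> Arr \<Omega>" "Src \<Omega> a = v" by (auto simp: arrows_from_def)
    then show "\<p> a \<in> arrows_from \<Lambda> y"
      using py proj.map_closed[OF a(1)] proj.map_src[OF a(1)] by (simp add: arrows_from_def)
  next
    fix \<alpha> assume "\<alpha> \<in> arrows_from \<Lambda> y"
    then have \<alpha>: "\<alpha> \<in> Arr \<Lambda>" "Src \<Lambda> \<alpha> = y" by (auto simp: arrows_from_def)
    have "based u (Src \<Lambda> \<alpha>)" using v \<alpha> by simp
    note a = arrow_over_src[OF this \<alpha>(1)]
    have "arrow (u @ [(\<alpha>, False)]) \<alpha> \<in> arrows_from \<Omega> v"
      using a v(1) \<alpha>(2) Arr_total by (auto simp: arrows_from_def)
    then show "\<exists>a\<in>arrows_from \<Omega> v. \<alpha> = \<p> a" using proj_arrow[OF a(1)] by force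
  qed
  \<comment> \<open>At a fixed range the class is already given, so an arrow amounts to its
    projection.\<close>
  show "bij_betw \<p> (arrows_to \<Omega> v) (arrows_to \<Lambda> (\<p> v))"
    unfolding py
  proof (rule bij_betwI')
    fix a b assume "a \<in> arrows_to \<Omega> v" "b \<in> arrows_to \<Omega> v"
    then obtain w \<alpha> w' \<beta> where ab: "a = arrow w \<alpha>" "based w \<alpha>" "b = arrow w' \<beta>" "based w' \<beta>"
      "Rng \<Omega> a = Rng \<Omega> b"
      unfolding arrows_to_def using Arr_total by auto
    show "(\<p> a = \<p> b) = (a = b)"
    proof
      assume "\<p> a = \<p> b"
      then have "\<beta> = \<alpha>" using ab proj_arrow by simp
      note ab = ab[unfolded this]
      have "\<alpha> \<in> Arr \<Lambda>" using ab by (simp add: based_def)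
      then have "zigzag_class \<Lambda> (x, w, Rng \<Lambda> \<alpha>) = zigzag_class \<Lambda> (x, w', Rng \<Lambda> \<alpha>)"
        using ab(5) arrow_eq_iff[OF based_rng[OF ab(2)] based_rng[OF ab(4)]]
        unfolding ab(1,3) Rng_arrow[OF ab(2)] Rng_arrow[OF ab(4)] by (simp add: rng_rng)
      then show "a = b" using arrow_eq_iff[OF ab(2,4)] ab(1,3) by simp
    qed simp
  next
    fix a assume "a \<in> arrows_to \<Omega> v"
    then have a: "a \<in> Arr \<Omega>" "Rng \<Omega> a = v" by (auto simp: arrows_to_def)
    then show "\<p> a \<in> arrows_to \<Lambda> y"
      using py proj.map_closed[OF a(1)] proj.map_rng[OF a(1)] by (simp add: arrows_to_def)
  next
    fix \<alpha> assume "\<alpha> \<in> arrows_to \<Lambda> y"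
    then have \<alpha>: "\<alpha> \<in> Arr \<Lambda>" "Rng \<Lambda> \<alpha> = y" by (auto simp: arrows_to_def)
    have a: "based u \<alpha>" using v \<alpha> by (simp add: based_def)
    have "arrow u \<alpha> \<in> arrows_to \<Omega> v"
      using a v(1) \<alpha>(2) Arr_total Rng_arrow[OF a] by (auto simp: arrows_to_def)
    then show "\<exists>a\<in>arrows_to \<Omega> v. \<alpha> = \<p> a" using proj_arrow[OF a] by force
  qed
qed

section \<open>Endpoints of lifted zigzags\<close>

sublocale covering: kgraph_covering k \<Lambda> \<Omega> \<p>
  by unfold_locales (rule covering_proj)

text \<open>Induction along \<open>W\<close> with the start vertex varying: \<open>w\<close>
  accumulates the images of the letters already passed, each with its direction.\<close>

lemma zigzag_total_endpoint:
  assumes "is_zigzag \<Omega> v W u" "v = arrow w y" "based w y" "y \<in> Ob \<Lambda>"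
  shows "is_zigzag \<Lambda> x (w @ zigzag_map \<p> W) (\<p> u) \<and> u = arrow (w @ zigzag_map \<p> W) (\<p> u)"
  using assms
proof (induction W arbitrary: v w y)
  case Nil
  then show ?case by (auto simp: proj_arrow based_vertex)
next
  case (Cons l W)
  obtain a b where l: "l = (a, b)" by fastforce
  have "a \<in> Arr \<Omega>" using Cons.prems l by simp
  then obtain w' \<alpha> where a: "a = arrow w' \<alpha>" "based w' \<alpha>" using Arr_total by metis
  have \<alpha>: "\<alpha> \<in> Arr \<Lambda>" using a by (simp add: based_def)
  have W: "is_zigzag \<Omega> (letter_src \<Omega> (a, b)) W u" and r: "letter_rng \<Omega> (a, b) = arrow w y"
    using Cons.prems l by auto
  have w: "is_zigzag \<Lambda> x w y" using Cons.prems based_vertex by blast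
  have "letter_src \<Omega> (a, b) = arrow (w @ [(\<alpha>, b)]) (letter_src \<Lambda> (\<alpha>, b)) \<and>
      based (w @ [(\<alpha>, b)]) (letter_src \<Lambda> (\<alpha>, b))"
  proof (cases b)
    case True
    then have "arrow w' (Rng \<Lambda> \<alpha>) = arrow w y" using r a by (simp add: letter_rng_def Rng_arrow)
    then have y: "Rng \<Lambda> \<alpha> = y" and eq: "zigzag_class \<Lambda> (x, w', Rng \<Lambda> \<alpha>) = zigzag_class \<Lambda> (x, w, Rng \<Lambda> \<alpha>)"
      using arrow_eq_iff[OF based_rng[OF a(2)] Cons.prems(3)] \<alpha> by (auto simp: rng_rng)
    have "based w \<alpha>" using w y \<alpha> by (simp add: based_def)
    moreover have "a = arrow w \<alpha>" using arrow_eq_iff[OF a(2) \<open>based w \<alpha>\<close>] eq a(1) by simp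
    ultimately show ?thesis using True by (simp add: letter_src_def Src_arrow based_src)
  next
    case False
    then have "arrow (w' @ [(\<alpha>, True)]) (Src \<Lambda> \<alpha>) = arrow w y"
      using r a by (simp add: letter_rng_def Src_arrow)
    then have y: "Src \<Lambda> \<alpha> = y"
      and eq: "zigzag_class \<Lambda> (x, w' @ [(\<alpha>, True)], Src \<Lambda> \<alpha>) = zigzag_class \<Lambda> (x, w, Src \<Lambda> \<alpha>)"
      using arrow_eq_iff[OF based_src[OF a(2)] Cons.prems(3)] \<alpha> by (auto simp: rng_src)
    have b: "based (w @ [(\<alpha>, False)]) \<alpha>"
      using arrow_over_src(1)[of w \<alpha>] Cons.prems(3) y \<alpha> by simp
    \<comment> \<open>\<open>arrow_over_src\<close> provides an arrow over \<alpha> with the source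
      of \<open>a\<close>. By unique lifting it is \<open>a\<close>, now with a name ending in the
      inverse letter.\<close>
    have "Src \<Omega> a = Src \<Omega> (arrow (w @ [(\<alpha>, False)]) \<alpha>)"
      using arrow_over_src(2)[of w \<alpha>] Cons.prems(3) y \<alpha> r False by (simp add: letter_rng_def)
    then have "a = arrow (w @ [(\<alpha>, False)]) \<alpha>"
      using covering.lift_src_unique[OF \<open>a \<in> Arr \<Omega>\<close>] b Arr_total a proj_arrow by metis
    then show ?thesis using b False by (simp add: letter_src_def Rng_arrow based_rng)
  qed
  moreover have "letter_src \<Lambda> (\<alpha>, b) \<in> Ob \<Lambda>" using \<alpha> by (simp add: letter_src_def src_Ob rng_Ob)
  ultimately have "is_zigzag \<Lambda> x ((w @ [(\<alpha>, b)]) @ zigzag_map \<p> W) (\<p> u) \<and>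
      u = arrow ((w @ [(\<alpha>, b)]) @ zigzag_map \<p> W) (\<p> u)"
    using Cons.IH[OF W] by blast
  then show ?case using l a proj_arrow by simp
qed

text \<open>The lift of \<open>w\<close> at the vertex of the empty word ends at the vertex named by
  \<open>w\<close>, and every vertex has such a name.\<close>

lemma connected_total: "connected_cat \<Omega>"
proof (rule covering.total.connected_catI[of "arrow [] x"])
  fix v assume "v \<in> Ob \<Omega>"
  then obtain w y where v: "v = arrow w y" "y \<in> Ob \<Lambda>" "is_zigzag \<Lambda> x w y" "based w y" by (rule ObE)
  have b: "based [] x" "\<p> (arrow [] x) = x" using x by (auto simp: based_vertex proj_arrow)
  \<comment> \<open>This vertex is its own range, so \<open>src_rng\<close> applies;
    \<open>Src_arrow\<close> would append a letter to its name.\<close>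
  have "Src \<Omega> (arrow [] x) = arrow [] x"
    using covering.total.src_rng[of "arrow [] x"] Rng_arrow[OF b(1)] x Arr_total b(1) by (auto simp: Ob_iff)
  then have "arrow [] x \<in> Ob \<Omega>" using b Arr_total by (auto simp: Ob_def)
  then obtain W u where W: "is_zigzag \<Omega> (arrow [] x) W u" "zigzag_map \<p> W = w"
    using covering.zigzag_lift b v(3) by metis
  have "is_zigzag \<Lambda> x w (\<p> u)" "u = arrow w (\<p> u)"
    using zigzag_total_endpoint[OF W(1) refl b(1) x] W(2) by simp_all
  then have "u = v" using is_zigzag_endpoint v by metis
  then show "\<exists>W. is_zigzag \<Omega> (arrow [] x) W v" using W by blast
qed

text \<open>A zigzag \<open>w\<close> lifted to \<open>\<Omega>\<close> at the vertex \<open>g\<close> ends at \<open>g[w]\<close>, so that only null-homotopic loops lift to loops.\<close>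

lemma null_loops_over:
  assumes "cat_functor \<Sigma> \<Omega> \<phi>" "\<And>\<alpha>. \<alpha> \<in> Arr \<Sigma> \<Longrightarrow> \<p> (\<phi> \<alpha>) = q \<alpha>" "v \<in> Ob \<Sigma>"
  shows "null_loops \<Lambda> \<Sigma> q v"
  unfolding null_loops_def
proof (intro allI impI)
  fix W assume W: "is_zigzag \<Sigma> v W v"
  interpret \<phi>: cat_functor \<Sigma> \<Omega> \<phi> by (rule assms)
  obtain w y where v: "\<phi> v = arrow w y" "y \<in> Ob \<Lambda>" "is_zigzag \<Lambda> x w y" "based w y"
    using ObE[OF \<phi>.map_Ob[OF assms(3)]] by blast
  have qv: "q v = y" "\<p> (\<phi> v) = y" using assms(2)[of v] assms(3) v proj_arrow by (auto simp: Ob_def)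
  have m: "zigzag_map \<p> (zigzag_map \<phi> W) = zigzag_map q W"
    using \<phi>.dom.is_zigzag_letters[OF W] assms(2) by (auto simp: apfst_def map_prod_def split: prod.split)
  \<comment> \<open>The loop \<open>zigzag_map \<phi> W\<close> ends at the vertex named by
    \<open>w\<close> followed by its projection, which is again \<open>\<phi> v\<close>.\<close>
  then have u: "is_zigzag \<Lambda> x (w @ zigzag_map q W) y" "arrow w y = arrow (w @ zigzag_map q W) y"
    using zigzag_total_endpoint[OF \<phi>.is_zigzag_map[OF W] v(1,4,2), unfolded m qv(2)] v(1) by metis+
  have eq: "zigzag_class \<Lambda> (x, w, y) = zigzag_class \<Lambda> (x, w @ zigzag_map q W, y)"
    using arrow_eq_iff[OF v(4), of "w @ zigzag_map q W" y] u v(2) by (simp add: based_vertex Ob_iff)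
  \<comment> \<open>Cancelling \<open>w\<close> on the left through an inverse path leaves the image
    of \<open>W\<close> null-homotopic.\<close>
  obtain w' where w': "is_zigzag \<Lambda> y w' x" "zigzag_class \<Lambda> (y, w' @ w, y) = zigzag_class \<Lambda> (y, [], y)"
    using zigzag_class_inverse[OF v(3)] by blast
  have W': "is_zigzag \<Lambda> y (zigzag_map q W) y"
    using u(1) v(3) is_zigzag_append_iff is_zigzag_endpoint by metis
  have "is_zigzag \<Lambda> y [] y" using v(2) by simp
  have "zigzag_class \<Lambda> (y, (w' @ w) @ zigzag_map q W, y) = zigzag_class \<Lambda> (y, [] @ zigzag_map q W, y)"
    using Cmp_fundamental_groupoid[OF is_zigzag_append[OF w'(1) v(3)] W']
      Cmp_fundamental_groupoid[OF \<open>is_zigzag \<Lambda> y [] y\<close> W'] w'(2) by simp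
  moreover have "zigzag_class \<Lambda> (y, w' @ (w @ zigzag_map q W), y) = zigzag_class \<Lambda> (y, w' @ w, y)"
    using Cmp_fundamental_groupoid[OF w'(1) v(3)] Cmp_fundamental_groupoid[OF w'(1) u(1)] eq by simp
  ultimately show "zigzag_class \<Lambda> (q v, zigzag_map q W, q v) = zigzag_class \<Lambda> (q v, [], q v)"
    using w'(2) qv by simp
qed

end

text \<open>\<open>kgraph_covering_morphism\<close> applies to test coverings over any type, so null
  loops at one vertex give universality for every choice of \<open>'c\<close>.\<close>

lemma null_loops_universal:
  assumes "connected_covering k \<Lambda> \<Omega> p" "v \<in> Ob \<Omega>" "null_loops \<Lambda> \<Omega> p v"
  shows "universal_covering TYPE('c) k \<Lambda> \<Omega> p"
  unfolding universal_covering_def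
proof (intro conjI allI impI)
  show "connected_covering k \<Lambda> \<Omega> p" by (rule assms(1))
  show "\<exists>\<phi>. covering_morphism k \<Omega> p \<Sigma> q \<phi>" if "connected_covering k \<Lambda> \<Sigma> q" for \<Sigma> :: "'c kgraph" and q
    by (rule kgraph_covering_morphism[OF assms]) (use that in \<open>simp add: connected_covering_def\<close>)
qed

section \<open>Cardinality\<close>

lemma ex_inj_pair:
  assumes "infinite (UNIV :: 'x set)" shows "\<exists>g :: 'x \<times> 'x \<Rightarrow> 'x. inj g"
proof -
  have "\<exists>g. bij_betw g (UNIV \<times> UNIV :: ('x \<times> 'x) set) (UNIV :: 'x set)"
    using card_of_Times_same_infinite[OF assms] by (simp only: card_of_ordIso)
  then show ?thesis by (auto simp: bij_betw_def)
qed

text \<open>An infinite type has an injective pairing, and nested pairs encode words. The summand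
  \<open>nat\<close> makes the type infinite and also holds flags and lengths.\<close>

lemma ex_inj_zigzag: "\<exists>e :: 'a zigzag \<times> 'a \<Rightarrow> 'a + nat. inj e"
proof -
  have "infinite (UNIV :: ('a + nat) set)" by simp
  then obtain g :: "('a + nat) \<times> ('a + nat) \<Rightarrow> 'a + nat" where g: "inj g" using ex_inj_pair by blast
  \<comment> \<open>The value \<open>Inr 0\<close> for the empty word may also be a value of
    \<open>g\<close>, so injectivity is claimed only among words of equal length; \<open>e\<close>
    records the length separately.\<close>
  define enc :: "'a letter list \<Rightarrow> 'a + nat" where
    "enc w = foldr (\<lambda>(\<alpha>, b) c. g (g (Inl \<alpha>, Inr (of_bool b)), c)) w (Inr 0)" for w
  have enc: "w = w'" if "length w = length w'" "enc w = enc w'" for w w'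
    using that
    by (induction w w' rule: list_induct2) (auto simp: enc_def inj_eq[OF g] of_bool_def split: prod.splits if_splits)
  define e :: "'a zigzag \<times> 'a \<Rightarrow> 'a + nat" where
    "e = (\<lambda>((x, w, y), \<alpha>). g (Inl x, g (Inl y, g (Inl \<alpha>, g (Inr (length w), enc w)))))"
  have "inj e" by (rule injI) (auto simp: e_def inj_eq[OF g] intro: enc)
  then show ?thesis by blast
qed

text \<open>A class is recovered from any of its members, so encoding its
  \<open>representative\<close> suffices.\<close>

lemma ex_inj_based_arrows: "\<exists>e :: 'a zigzag set \<times> 'a \<Rightarrow> 'a + nat. inj_on e (based_arrows C x)"
proof -
  obtain e :: "'a zigzag \<times> 'a \<Rightarrow> 'a + nat" where e: "inj e" using ex_inj_zigzag by blast
  have "inj_on (\<lambda>(g, \<alpha>). e (representative g, \<alpha>)) (based_arrows C x)"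
  proof (rule inj_onI)
    fix s t assume s: "s \<in> based_arrows C x" and t: "t \<in> based_arrows C x"
      and eq: "(\<lambda>(g, \<alpha>). e (representative g, \<alpha>)) s = (\<lambda>(g, \<alpha>). e (representative g, \<alpha>)) t"
    obtain w \<alpha> where w: "s = (zigzag_class C (x, w, Rng C \<alpha>), \<alpha>)" "is_zigzag C x w (Rng C \<alpha>)"
      using s by (auto simp: based_arrows_def)
    obtain w' \<beta> where w': "t = (zigzag_class C (x, w', Rng C \<beta>), \<beta>)" "is_zigzag C x w' (Rng C \<beta>)"
      using t by (auto simp: based_arrows_def)
    have "representative (zigzag_class C (x, w, Rng C \<alpha>)) = representative (zigzag_class C (x, w', Rng C \<beta>))"
      "\<alpha> = \<beta>"
      using eq w w' by (auto simp: inj_eq[OF e])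
    then show "s = t"
      using representative_zigzag_class[OF w(2)] representative_zigzag_class[OF w'(2)] zigzag_class_eqI w(1) w'(1)
      by metis
  qed
  then show ?thesis by blast
qed

section \<open>Existence and characterization of universal coverings\<close>

theorem theorem2p7:
  fixes k :: nat and \<Lambda> :: "'a kgraph"
  assumes "k_graph k \<Lambda>" and "connected_cat \<Lambda>"
  shows "(\<exists>(\<Omega> :: ('a + nat) kgraph) p. universal_covering TYPE('a + nat) k \<Lambda> \<Omega> p)
    \<and> (\<forall>(\<Omega> :: 'b kgraph) p. connected_covering k \<Lambda> \<Omega> p \<longrightarrow>
         (universal_covering TYPE('a + nat) k \<Lambda> \<Omega> p \<longleftrightarrow>
           (\<exists>x \<in> Ob \<Lambda>. \<exists>v \<in> Ob \<Omega>. p v = x \<and>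
              induced \<Lambda> p ` carrier (fundamental_group \<Omega> v) = {\<one>\<^bsub>fundamental_group \<Lambda> x\<^esub>}))
       \<and> (universal_covering TYPE('a + nat) k \<Lambda> \<Omega> p \<longleftrightarrow>
           (\<forall>x \<in> Ob \<Lambda>. \<forall>v \<in> Ob \<Omega>. p v = x \<longrightarrow>
              induced \<Lambda> p ` carrier (fundamental_group \<Omega> v) = {\<one>\<^bsub>fundamental_group \<Lambda> x\<^esub>}))
       \<and> (universal_covering TYPE('a + nat) k \<Lambda> \<Omega> p \<longrightarrow> universal_covering TYPE('c) k \<Lambda> \<Omega> p))"
proof -
  interpret k_graph k \<Lambda> by (rule assms(1))
  obtain x where x: "x \<in> Ob \<Lambda>" using nonempty src_Ob by blast
  obtain e :: "'a zigzag set \<times> 'a \<Rightarrow> 'a + nat" where e: "inj_on e (based_arrows \<Lambda> x)"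
    using ex_inj_based_arrows[of \<Lambda> x] by blast
  \<comment> \<open>Encoding the classes in \<open>'a + nat\<close> makes this covering one of the
    test coverings of the statement.\<close>
  interpret U: path_covering k \<Lambda> x e by unfold_locales (use assms(2) x e in auto)
  have U: "connected_covering k \<Lambda> U.total_kgraph U.proj"
    using U.covering_proj U.connected_total by (simp add: connected_covering_def)
  obtain v where v: "v \<in> Ob U.total_kgraph" using U.covering.vertex_lift[OF x] by blast
  \<comment> \<open>The identity maps this covering to itself, so \<open>null_loops_over\<close>
    shows that its own loops are null, whence it is universal.\<close>
  have "cat_functor U.total_kgraph U.total_kgraph (\<lambda>a. a)" by unfold_locales auto
  then have "null_loops \<Lambda> U.total_kgraph U.proj v" by (rule U.null_loops_over) (use v in auto)
  then have ex: "universal_covering TYPE('a + nat) k \<Lambda> U.total_kgraph U.proj"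
    by (rule null_loops_universal[OF U v])
  have char: "(universal_covering TYPE('a + nat) k \<Lambda> \<Omega> p \<longleftrightarrow>
           (\<exists>x \<in> Ob \<Lambda>. \<exists>v \<in> Ob \<Omega>. p v = x \<and>
              induced \<Lambda> p ` carrier (fundamental_group \<Omega> v) = {\<one>\<^bsub>fundamental_group \<Lambda> x\<^esub>}))
       \<and> (universal_covering TYPE('a + nat) k \<Lambda> \<Omega> p \<longleftrightarrow>
           (\<forall>x \<in> Ob \<Lambda>. \<forall>v \<in> Ob \<Omega>. p v = x \<longrightarrow>
              induced \<Lambda> p ` carrier (fundamental_group \<Omega> v) = {\<one>\<^bsub>fundamental_group \<Lambda> x\<^esub>}))
       \<and> (universal_covering TYPE('a + nat) k \<Lambda> \<Omega> p \<longrightarrow> universal_covering TYPE('c) k \<Lambda> \<Omega> p)"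
    if con: "connected_covering k \<Lambda> \<Omega> p" for \<Omega> :: "'b kgraph" and p
  proof -
    interpret p: kgraph_covering k \<Lambda> \<Omega> p
      using con by unfold_locales (simp add: connected_covering_def)
    note iff = induced_trivial_iff[OF p.cat_functor_axioms]
    \<comment> \<open>A universal covering maps to \<open>U\<close>, and
      \<open>null_loops_over\<close> then gives null loops at each of its vertices.\<close>
    have all: "null_loops \<Lambda> \<Omega> p v" if uni: "universal_covering TYPE('a + nat) k \<Lambda> \<Omega> p" and v: "v \<in> Ob \<Omega>" for v
    proof -
      obtain \<phi> where "covering_morphism k \<Omega> p U.total_kgraph U.proj \<phi>"
        using uni U unfolding universal_covering_def by blast
      then show ?thesis
        using U.null_loops_over[of \<Omega> \<phi> p v] v by (auto simp: covering_morphism_def kgraph_morphism_def)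
    qed
    \<comment> \<open>Since a vertex exists, null loops at all vertices imply null loops at some
      vertex, and \<open>null_loops_universal\<close> closes the circle for either test
      type.\<close>
    obtain v where "v \<in> Ob \<Omega>" using p.vertex_lift[OF x] by blast
    then have "universal_covering TYPE('a + nat) k \<Lambda> \<Omega> p \<longleftrightarrow> (\<exists>v \<in> Ob \<Omega>. null_loops \<Lambda> \<Omega> p v)"
      "universal_covering TYPE('a + nat) k \<Lambda> \<Omega> p \<longleftrightarrow> (\<forall>v \<in> Ob \<Omega>. null_loops \<Lambda> \<Omega> p v)"
      "universal_covering TYPE('a + nat) k \<Lambda> \<Omega> p \<Longrightarrow> universal_covering TYPE('c) k \<Lambda> \<Omega> p"
      using all null_loops_universal[OF con] by metis+
    \<comment> \<open>The quantifier over \<open>x\<close> collapses because \<open>p v\<close> is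
      always a vertex of \<Lambda>.\<close>
    moreover have "(\<exists>x \<in> Ob \<Lambda>. \<exists>v \<in> Ob \<Omega>. p v = x \<and>
        induced \<Lambda> p ` carrier (fundamental_group \<Omega> v) = {\<one>\<^bsub>fundamental_group \<Lambda> x\<^esub>}) \<longleftrightarrow>
        (\<exists>v \<in> Ob \<Omega>. null_loops \<Lambda> \<Omega> p v)"
      using p.map_Ob iff by metis
    moreover have "(\<forall>x \<in> Ob \<Lambda>. \<forall>v \<in> Ob \<Omega>. p v = x \<longrightarrow>
        induced \<Lambda> p ` carrier (fundamental_group \<Omega> v) = {\<one>\<^bsub>fundamental_group \<Lambda> x\<^esub>}) \<longleftrightarrow>
        (\<forall>v \<in> Ob \<Omega>. null_loops \<Lambda> \<Omega> p v)"
      using p.map_Ob iff by auto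
    ultimately show ?thesis by simp
  qed
  show ?thesis using ex char by blast
qed

end
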